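(* Let $\mathcal{P}$ be a simple finite-dimensional non-trivial transposed Poisson algebra over an algebraically closed field of characteristic $p>3$. Then there is $n\in\mathbb{N}$ such that $\dim(\mathcal{P})=p^n$ and $q\in\mathcal{W}(1;n)$ such that $\mathcal{P}$ is isomorphic to the algebra $\mathcal{W}_n(q)$.
   Context: A transposed Poisson algebra over a field $\mathbb{F}$ of characteristic $\neq 2$ is a vector space $\mathcal{P}$ with an associative commutative multiplication $\circ$ (not assumed unital) and a Lie bracket $[\cdot,\cdot]$ satisfying $2x\circ[y,z]=[x\circ y,z]+[y,x\circ z]$ for all $x,y,z\in\mathcal{P}$. An ideal is a subspace that is an ideal for both multiplications simultaneously; $\mathcal{P}$ is simple if it has exactly two ideals, zero and $\mathcal{P}$. It is trivial if one of the two multiplications is zero, and non-trivial otherwise. An isomorphism is a linear bijection preserving both multiplications. For $n\geq 1$, the divided powers algebra $\mathcal{O}(1;n)$ is the commutative associative unital algebra with basis $x^{(i)}$, $0\le i<p^n$, and multiplication $x^{(i)}x^{(j)}=\binom{i+j}{j}x^{(i+j)}$ with $x^{(k)}=0$ for $k\geq p^n$. Let $\partial$ be its derivation with $\partial(x^{(i)})=x^{(i-1)}$ ($\partial(x^{(0)})=0$). The Zassenhaus algebra is $\mathcal{W}(1;n)=\mathcal{O}(1;n)\partial$ with Lie bracket $[f\partial,g\partial]=(f\,\partial(g)-\partial(f)\,g)\partial$. Let $\bullet$ be the commutative associative product on $\mathcal{W}(1;n)$ given by $(f\partial)\bullet(g\partial)=(fg)\partial$; equivalently, in the basis $e_i=x^{(i+1)}\partial$,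 $-1\le i\le p^n-2$, $e_i\bullet e_j=\binom{i+j+2}{j+1}e_{i+j+1}$ (zero if $i+j+1>p^n-2$). For $q\in\mathcal{W}(1;n)$, $\mathcal{W}_n(q)$ is the vector space $\mathcal{W}(1;n)$ with its Lie bracket and the associative commutative product $x\bullet_q y=x\bullet q\bullet y$. *)

theory Defs
  imports "HOL-Computational_Algebra.Computational_Algebra" "HOL-Library.Function_Algebras"
begin

section \<open>Transposed Poisson algebras\<close>

text \<open>
  The underlying space of the algebra is the whole type \<open>'v\<close>. The associative multiplication
  is not assumed to have a unit.
\<close>

locale transposed_poisson_algebra = vector_space scale
  for scale :: "'k::field \<Rightarrow> 'v::ab_group_add \<Rightarrow> 'v" +
  fixes circ :: "'v \<Rightarrow> 'v \<Rightarrow> 'v"  (infixl \<open>\<odot>\<close> 70)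
    and bracket :: "'v \<Rightarrow> 'v \<Rightarrow> 'v"
  assumes char_neq_2: "CHAR('k) \<noteq> 2"
    and mult_linear_left: "Vector_Spaces.linear scale scale (\<lambda>x. x \<odot> y)"
    and mult_linear_right: "Vector_Spaces.linear scale scale (\<lambda>y. x \<odot> y)"
    and mult_assoc: "(x \<odot> y) \<odot> z = x \<odot> (y \<odot> z)"
    and mult_commute: "x \<odot> y = y \<odot> x"
    and bracket_linear_left: "Vector_Spaces.linear scale scale (\<lambda>x. bracket x y)"
    and bracket_linear_right: "Vector_Spaces.linear scale scale (\<lambda>y. bracket x y)"
    and bracket_alternating: "bracket x x = 0"
    and jacobi:
      "bracket x (bracket y z) + bracket y (bracket z x) + bracket z (bracket x y) = 0"
    and transposed_leibniz:
      "scale 2 (x \<odot> bracket y z) = bracket (x \<odot> y) z + bracket y (x \<odot> z)"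
begin

text \<open>
  One-sided conditions suffice, since \<open>\<odot>\<close> is commutative and the bracket is anticommutative.
\<close>

definition is_ideal :: "'v set \<Rightarrow> bool" where
  "is_ideal I \<longleftrightarrow> subspace I \<and> (\<forall>a. \<forall>x\<in>I. a \<odot> x \<in> I \<and> bracket a x \<in> I)"

definition is_simple :: bool where
  "is_simple \<longleftrightarrow> {I. is_ideal I} = {{0}, UNIV} \<and> {0} \<noteq> (UNIV :: 'v set)"

definition is_trivial :: bool where
  "is_trivial \<longleftrightarrow> (\<forall>x y. x \<odot> y = 0) \<or> (\<forall>x y. bracket x y = 0)"

end


section \<open>Divided powers algebras\<close>

text \<open>
  With \<open>p = CHAR('k)\<close>, the element \<open>\<Sum>i<p^n. a i * x\<^sup>(\<^sup>i\<^sup>)\<close> of the divided powers algebra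
  is represented by its coefficient function \<open>a\<close>, extended by zero to all of \<open>nat\<close>.
  Addition is the pointwise one of Function_Algebras; the pointwise product of that
  theory is never used.
\<close>

definition coeff_scale :: "'k::field \<Rightarrow> (nat \<Rightarrow> 'k) \<Rightarrow> (nat \<Rightarrow> 'k)" where
  "coeff_scale c f = (\<lambda>i. c * f i)"

definition dp_carrier :: "nat \<Rightarrow> (nat \<Rightarrow> 'k::field) set" where
  "dp_carrier n = {f. \<forall>i. CHAR('k) ^ n \<le> i \<longrightarrow> f i = 0}"

text \<open>
  Bilinear extension of \<open>x\<^sup>(\<^sup>i\<^sup>) x\<^sup>(\<^sup>j\<^sup>) = (i + j choose j) x\<^sup>(\<^sup>i\<^sup>+\<^sup>j\<^sup>)\<close>, where \<open>x\<^sup>(\<^sup>k\<^sup>) = 0\<close> for \<open>k \<ge> p^n\<close>;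
  see \<open>dp_mult_basis\<close> below.
\<close>

definition dp_mult :: "nat \<Rightarrow> (nat \<Rightarrow> 'k::field) \<Rightarrow> (nat \<Rightarrow> 'k) \<Rightarrow> (nat \<Rightarrow> 'k)" where
  "dp_mult n f g =
     (\<lambda>k. if k < CHAR('k) ^ n then \<Sum>j\<le>k. of_nat (k choose j) * f (k - j) * g j else 0)"

definition dp_deriv :: "(nat \<Rightarrow> 'k::field) \<Rightarrow> (nat \<Rightarrow> 'k)" where
  "dp_deriv f = (\<lambda>i. f (Suc i))"

definition dp_basis :: "nat \<Rightarrow> nat \<Rightarrow> 'k::field" where
  "dp_basis i = (\<lambda>k. if k = i then 1 else 0)"

lemma vector_space_coeff_scale: "vector_space coeff_scale"
  by unfold_locales (auto simp: coeff_scale_def fun_eq_iff algebra_simps)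

lemma dp_mult_basis:
  "dp_mult n (dp_basis i) (dp_basis j :: nat \<Rightarrow> 'k::field) =
     (if i + j < CHAR('k) ^ n then coeff_scale (of_nat (i + j choose j)) (dp_basis (i + j)) else 0)"
proof (rule ext)
  fix k
  have "(\<Sum>l\<le>k. of_nat (k choose l) * dp_basis i (k - l) * dp_basis j l) =
      (\<Sum>l\<le>k. if l = j then of_nat (k choose l) * dp_basis i (k - l) else (0::'k))"
    by (intro sum.cong) (auto simp: dp_basis_def)
  also have "\<dots> = (if k = i + j then of_nat (i + j choose j) else 0)"
    by (auto simp: dp_basis_def)
  finally show "dp_mult n (dp_basis i) (dp_basis j :: nat \<Rightarrow> 'k) k = (if i + j < CHAR('k) ^ n
      then coeff_scale (of_nat (i + j choose j)) (dp_basis (i + j)) else 0) k"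
    by (auto simp: dp_mult_def coeff_scale_def dp_basis_def)
qed

lemma dp_deriv_basis:
  "dp_deriv (dp_basis i) = (case i of 0 \<Rightarrow> 0 | Suc j \<Rightarrow> dp_basis j)"
  by (auto simp: dp_deriv_def dp_basis_def fun_eq_iff split: nat.splits)


section \<open>Zassenhaus algebras\<close>

text \<open>
  The element \<open>f\<partial>\<close> of the Zassenhaus algebra is represented by \<open>f\<close>, so that the two
  spaces have the same carrier and \<open>e\<^sub>i\<close> is \<open>dp_basis (i + 1)\<close>.
\<close>

definition zassenhaus_carrier :: "nat \<Rightarrow> (nat \<Rightarrow> 'k::field) set" where
  "zassenhaus_carrier n = dp_carrier n"

definition zassenhaus_bracket :: "nat \<Rightarrow> (nat \<Rightarrow> 'k::field) \<Rightarrow> (nat \<Rightarrow> 'k) \<Rightarrow> (nat \<Rightarrow> 'k)" where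
  "zassenhaus_bracket n f g = dp_mult n f (dp_deriv g) - dp_mult n (dp_deriv f) g"

definition zassenhaus_mult :: "nat \<Rightarrow> (nat \<Rightarrow> 'k::field) \<Rightarrow> (nat \<Rightarrow> 'k) \<Rightarrow> (nat \<Rightarrow> 'k)" where
  "zassenhaus_mult n f g = dp_mult n f g"

definition zassenhaus_mult_q ::
  "nat \<Rightarrow> (nat \<Rightarrow> 'k::field) \<Rightarrow> (nat \<Rightarrow> 'k) \<Rightarrow> (nat \<Rightarrow> 'k) \<Rightarrow> (nat \<Rightarrow> 'k)" where
  "zassenhaus_mult_q n q f g = zassenhaus_mult n (zassenhaus_mult n f q) g"

text \<open>
  Isomorphisms from a transposed Poisson algebra on the type \<open>'v\<close> onto the algebra given by
  \<open>zassenhaus_mult_q n q\<close> and \<open>zassenhaus_bracket n\<close> on \<open>zassenhaus_carrier n\<close>.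
\<close>

definition is_iso_zassenhaus ::
  "('k::field \<Rightarrow> 'v::ab_group_add \<Rightarrow> 'v) \<Rightarrow> ('v \<Rightarrow> 'v \<Rightarrow> 'v) \<Rightarrow> ('v \<Rightarrow> 'v \<Rightarrow> 'v) \<Rightarrow>
     nat \<Rightarrow> (nat \<Rightarrow> 'k) \<Rightarrow> ('v \<Rightarrow> nat \<Rightarrow> 'k) \<Rightarrow> bool" where
  "is_iso_zassenhaus scale circ bracket n q \<phi> \<longleftrightarrow>
     Vector_Spaces.linear scale coeff_scale \<phi> \<and>
     bij_betw \<phi> UNIV (zassenhaus_carrier n) \<and>
     (\<forall>x y. \<phi> (circ x y) = zassenhaus_mult_q n q (\<phi> x) (\<phi> y)) \<and>
     (\<forall>x y. \<phi> (bracket x y) = zassenhaus_bracket n (\<phi> x) (\<phi> y))"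

end

theory Submission
  imports Defs
begin

text \<open>
  For an operator \<open>f\<close> and a vector \<open>y\<close> write \<open>f\<^sub>y = [f, ad y]\<close>. The multiplication operators of a
  transposed Poisson algebra are half-derivations of the Lie bracket, form a commutative semigroup,
  and both properties survive when the operators \<open>f\<^sub>y\<close> are added, provided the characteristic is not
  \<open>2\<close> or \<open>3\<close>. Moreover \<open>f\<^sub>y z = f\<^sub>z y\<close>, so each \<open>f\<close> gives a new commutative associative product.
  Iterating, simplicity yields some invertible \<open>f\<^sub>y\<close>; its product is unital with a unit \<open>e\<close>,
  \<open>D = [e, \<cdot>]\<close> is a derivation, the bracket is \<open>x D y - D x y\<close> and the original product is \<open>x q y\<close>.
  Simplicity of the Poisson algebra means that there are no proper \<open>D\<close>-ideals.

  With \<open>\<epsilon>\<close> the character onto the algebraically closed field, \<open>x \<mapsto> (\<epsilon> (D\<^sup>i x))\<^sub>i\<close> embeds the algebra into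
  the full divided power series ring, where \<open>D\<close> becomes the shift. Counting orders, the dimension \<open>N\<close>
  kills all \<open>N choose j\<close> with \<open>0 < j < N\<close>, hence is a power \<open>p\<^sup>n\<close>. Replacing \<open>D\<close> by \<open>E = u D\<close> with \<open>u\<close>
  invertible changes the Lie algebra only by an isomorphism; it remains to find \<open>u\<close> such that the
  image under \<open>x \<mapsto> (\<epsilon> (E\<^sup>i x))\<^sub>i\<close> is the truncated algebra. For \<open>u = 1 / D y\<close> this amounts
  to \<open>y = y\<^sub>0\<close> admitting \<open>y\<^sub>1, \<dots>, y\<^sub>n\<^sub>-\<^sub>1\<close> with \<open>D y\<^sub>i\<^sub>+\<^sub>1 = y\<^sub>i\<^sup>p\<^sup>-\<^sup>1 D y\<^sub>i\<close>. The obstruction to each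
  step is Frobenius-semilinear, since \<open>((x + y)\<^sup>p - x\<^sup>p - y\<^sup>p) / p\<close> is a polynomial, and takes values in the
  one-dimensional cokernel of \<open>D\<close>; comparing orders shows that a suitable \<open>y\<close> exists.
\<close>

section \<open>The ring of divided power series\<close>

text \<open>The sequence \<open>a\<close> stands for the infinite sum of the
  \<open>a i * x\<^sup>(\<^sup>i\<^sup>)\<close>. A type of its own is used because functions
  already carry the pointwise product.\<close>

datatype 'a hurwitz = Hurwitz (hnth: "nat \<Rightarrow> 'a")

lemma hurwitz_eqI: "(\<And>i. hnth f i = hnth g i) \<Longrightarrow> f = g"
  by (cases f; cases g) (auto simp: fun_eq_iff)

definition hderiv :: "'a hurwitz \<Rightarrow> 'a hurwitz" where
  "hderiv f = Hurwitz (\<lambda>i. hnth f (Suc i))"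

lemma hnth_hderiv [simp]: "hnth (hderiv f) i = hnth f (Suc i)"
  by (simp add: hderiv_def)

instantiation hurwitz :: (comm_ring_1) comm_ring_1
begin

definition "0 = Hurwitz (\<lambda>_. 0)"
definition "1 = Hurwitz (\<lambda>i. if i = 0 then 1 else 0)"
definition "f + g = Hurwitz (\<lambda>i. hnth f i + hnth g i)"
definition "f - g = Hurwitz (\<lambda>i. hnth f i - hnth g i)"
definition "- f = Hurwitz (\<lambda>i. - hnth f i)"
definition "f * g =
  Hurwitz (\<lambda>k. \<Sum>j\<le>k. of_nat (k choose j) * hnth f (k - j) * hnth g j)"

lemma hnth_0 [simp]: "hnth 0 i = (0 :: 'a::comm_ring_1)"
  and hnth_1: "hnth 1 i = (if i = 0 then 1 else 0 :: 'a)"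
  and hnth_add [simp]: "hnth (f + g) i = hnth f i + (hnth g i :: 'a)"
  and hnth_diff [simp]: "hnth (f - g) i = hnth f i - (hnth g i :: 'a)"
  and hnth_minus [simp]: "hnth (- f) i = - (hnth f i :: 'a)"
  by (simp_all add: zero_hurwitz_def one_hurwitz_def plus_hurwitz_def minus_hurwitz_def
      uminus_hurwitz_def)

lemma hnth_mult:
  "hnth (f * g) k = (\<Sum>j\<le>k. of_nat (k choose j) * hnth f (k - j) * (hnth g j :: 'a))"
  by (simp add: times_hurwitz_def)

lemma hnth_mult_0 [simp]: "hnth (f * g) 0 = hnth f 0 * (hnth g 0 :: 'a)"
  by (simp add: hnth_mult)

text \<open>Pascal's rule. Together with index 0 it determines a product, so the ring laws and the
  multiplicativity of maps follow by induction on the index.\<close>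

lemma hnth_mult_Suc:
  "hnth (f * g) (Suc k) = hnth (hderiv f * g) k + (hnth (f * hderiv g) k :: 'a)"
proof -
  have "hnth (f * g) (Suc k) = hnth f (Suc k) * hnth g 0 +
      (\<Sum>j\<le>k. of_nat (Suc k choose Suc j) * hnth f (k - j) * hnth g (Suc j))"
    unfolding hnth_mult by (subst sum.atMost_Suc_shift) simp
  also have "(\<Sum>j\<le>k. of_nat (Suc k choose Suc j) * hnth f (k - j) * hnth g (Suc j)) =
     hnth (f * hderiv g) k + (\<Sum>j\<le>k. of_nat (k choose Suc j) * hnth f (k - j) * hnth g (Suc j))"
    by (simp add: hnth_mult algebra_simps sum.distrib)
  also have "(\<Sum>j\<le>k. of_nat (k choose Suc j) * hnth f (k - j) * hnth g (Suc j)) =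
      (\<Sum>j<k. of_nat (k choose Suc j) * hnth f (k - j) * hnth g (Suc j))"
    by (simp add: binomial_eq_0 flip: lessThan_Suc_atMost)
  also have "hnth f (Suc k) * hnth g 0 + (hnth (f * hderiv g) k + \<dots>) =
      hnth (f * hderiv g) k +
      (\<Sum>j\<le>k. of_nat (k choose j) * hnth f (Suc k - j) * hnth g j)"
  proof (cases k)
    case (Suc m)
    show ?thesis unfolding Suc sum.atMost_Suc_shift lessThan_Suc_atMost
      by simp
  qed simp
  also have "(\<Sum>j\<le>k. of_nat (k choose j) * hnth f (Suc k - j) * hnth g j) = hnth (hderiv f * g) k"
    unfolding hnth_mult by (intro sum.cong refl) (simp add: Suc_diff_le)
  finally show ?thesis by (simp add: add.commute)
qed

lemma hderiv_add: "hderiv (f + g) = hderiv f + hderiv (g :: 'a hurwitz)"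
  by (rule hurwitz_eqI) simp

lemma hderiv_mult: "hderiv (f * g) = hderiv f * g + f * hderiv (g :: 'a hurwitz)"
  by (rule hurwitz_eqI) (simp add: hnth_mult_Suc)

lemma hurwitz_distrib: "(f + g) * h = f * h + g * (h :: 'a hurwitz)"
  by (rule hurwitz_eqI) (simp add: hnth_mult algebra_simps sum.distrib)

lemma hurwitz_commute: "f * g = g * (f :: 'a hurwitz)"
proof -
  have "hnth (f * g) n = hnth (g * f) n" for n
    by (induction n arbitrary: f g) (simp_all add: hnth_mult_Suc ac_simps)
  then show ?thesis by (rule hurwitz_eqI)
qed

lemma hurwitz_assoc: "f * g * h = f * (g * h :: 'a hurwitz)"
proof -
  have distrib': "f * (g + h) = f * g + f * h" for f g h :: "'a hurwitz"
    by (metis hurwitz_commute hurwitz_distrib)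
  have "hnth (f * g * h) n = hnth (f * (g * h)) n" for n
    by (induction n arbitrary: f g h)
      (simp_all add: hnth_mult_Suc hderiv_mult hurwitz_distrib distrib' ac_simps)
  then show ?thesis by (rule hurwitz_eqI)
qed

instance
proof
  fix f g h :: "'a hurwitz"
  show "1 * f = f"
  proof (rule hurwitz_eqI)
    fix i
    have "hnth (f * 1) i = (\<Sum>j\<le>i. if j = 0 then hnth f i else 0)"
      unfolding hnth_mult by (intro sum.cong) (auto simp: hnth_1)
    then show "hnth (1 * f) i = hnth f i"
      by (simp add: hurwitz_commute[of 1])
  qed
  show "(0 :: 'a hurwitz) \<noteq> 1"
    by (metis hnth_0 hnth_1 zero_neq_one)
qed (rule hurwitz_assoc hurwitz_commute hurwitz_distrib
  | (rule hurwitz_eqI; simp add: algebra_simps))+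

end

definition hconst :: "'a::comm_ring_1 \<Rightarrow> 'a hurwitz" where
  "hconst c = Hurwitz (\<lambda>i. if i = 0 then c else 0)"

lemma hnth_hconst: "hnth (hconst c) i = (if i = 0 then c else 0)"
  by (simp add: hconst_def)

lemma hnth_hconst_mult [simp]: "hnth (hconst c * f) i = c * hnth f i"
proof -
  have "hnth (f * hconst c) i = (\<Sum>j\<le>i. if j = 0 then hnth f i * c else 0)"
    unfolding hnth_mult by (intro sum.cong) (auto simp: hnth_hconst)
  then show ?thesis by (simp add: mult.commute)
qed

lemma hconst_0 [simp]: "hconst 0 = 0"
  and hconst_1 [simp]: "hconst 1 = 1"
  and hconst_add: "hconst (a + b) = hconst a + hconst b"
  and hconst_minus: "hconst (- a) = - hconst a"
  and hconst_mult: "hconst (a * b) = hconst a * hconst b"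
  by (rule hurwitz_eqI; simp add: hnth_1 hnth_hconst)+

lemma hconst_power: "hconst (a ^ n) = hconst a ^ n"
  by (induction n) (simp_all add: hconst_mult)

lemma hconst_of_nat: "hconst (of_nat n) = of_nat n"
  by (induction n) (simp_all add: hconst_add)

lemma hderiv_hconst [simp]: "hderiv (hconst c) = 0"
  and hderiv_0 [simp]: "hderiv 0 = (0 :: 'a::comm_ring_1 hurwitz)"
  and hderiv_1 [simp]: "hderiv 1 = (0 :: 'a::comm_ring_1 hurwitz)"
  and hderiv_diff: "hderiv (f - g) = hderiv f - hderiv (g :: 'a::comm_ring_1 hurwitz)"
  by (rule hurwitz_eqI; simp add: hnth_hconst hnth_1)+

lemma hderiv_hconst_mult: "hderiv (hconst c * f) = hconst c * hderiv f"
  by (simp add: hderiv_mult)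

lemma hderiv_sum:
  fixes f :: "'b \<Rightarrow> 'a::comm_ring_1 hurwitz"
  shows "hderiv (sum f A) = (\<Sum>i\<in>A. hderiv (f i))"
  by (induction A rule: infinite_finite_induct) (simp_all add: hderiv_add)

lemma hderiv_power:
  "hderiv (f ^ n) = of_nat n * (f ^ (n - 1) * hderiv (f :: 'a::comm_ring_1 hurwitz))"
proof (induction n)
  case (Suc n)
  have "f * (of_nat n * (f ^ (n - 1) * hderiv f)) = of_nat n * (f ^ n * hderiv f)"
    by (cases n) (simp_all add: mult_ac)
  then show ?case
    by (simp add: hderiv_mult Suc algebra_simps)
qed simp

text \<open>Being a plain shift, \<open>hderiv\<close> loses only the constant term, in every
  characteristic. Equations are integrated by this rule.\<close>

lemma hderiv_eq_iff:
  "f = g \<longleftrightarrow> hnth f 0 = hnth g 0 \<and> hderiv f = hderiv g"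
proof (intro iffI hurwitz_eqI)
  fix i assume "hnth f 0 = hnth g 0 \<and> hderiv f = hderiv g"
  then show "hnth f i = hnth g i"
    by (cases i) (auto simp flip: hnth_hderiv)
qed simp

lemma of_nat_CHAR_hurwitz: "of_nat CHAR('a) = (0 :: 'a::comm_ring_1 hurwitz)"
  by (simp flip: hconst_of_nat)

lemma hnth_power_0: "hnth (f ^ n) 0 = hnth f 0 ^ n"
  by (induction n) (simp_all add: hnth_1)

text \<open>The derivative of the power contains the factor p and vanishes, so only the constant
  term survives.\<close>

lemma hurwitz_power_CHAR:
  fixes f :: "'a::comm_ring_1 hurwitz"
  assumes "CHAR('a) > 0"
  shows "f ^ CHAR('a) = hconst (hnth f 0 ^ CHAR('a))"
  by (subst hderiv_eq_iff)
    (simp add: hderiv_power of_nat_CHAR_hurwitz hnth_power_0 hnth_hconst)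

text \<open>A relation and not a function, since 0 has no order.\<close>

definition hord :: "'a::zero hurwitz \<Rightarrow> nat \<Rightarrow> bool" where
  "hord f m \<longleftrightarrow> (\<forall>i<m. hnth f i = 0) \<and> hnth f m \<noteq> 0"

text \<open>The leading coefficient of a product carries a binomial coefficient that can vanish
  modulo the characteristic, so orders need not add up.\<close>

lemma hnth_mult_low:
  fixes f g :: "'a::comm_ring_1 hurwitz"
  assumes f: "\<And>i. i < a \<Longrightarrow> hnth f i = 0" and g: "\<And>i. i < b \<Longrightarrow> hnth g i = 0"
  shows "k < a + b \<Longrightarrow> hnth (f * g) k = 0"
    and "hnth (f * g) (a + b) = of_nat (a + b choose b) * hnth f a * hnth g b"
proof -
  have "hnth f (k - j) * hnth g j = 0" if "j \<le> k" "k \<le> a + b" "k = a + b \<longrightarrow> j \<noteq> b" for k j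
  proof (cases "j < b")
    case False
    then have "k - j < a" using that by auto
    then show ?thesis by (simp add: f)
  qed (simp add: g)
  note * = this
  show "hnth (f * g) k = 0" if "k < a + b"
    unfolding hnth_mult by (rule sum.neutral) (use that * in \<open>auto simp: mult.assoc\<close>)
  have "hnth (f * g) (a + b) =
      (\<Sum>j\<le>a + b. if j = b then of_nat (a + b choose b) * hnth f a * hnth g b else 0)"
    unfolding hnth_mult by (intro sum.cong) (use * in \<open>auto simp: mult.assoc\<close>)
  then show "hnth (f * g) (a + b) = of_nat (a + b choose b) * hnth f a * hnth g b"
    by simp
qed

lemma hord_mult:
  fixes f g :: "'a::idom hurwitz"
  assumes "hord f a" "hord g b" "of_nat (a + b choose b) \<noteq> (0 :: 'a)"
  shows "hord (f * g) (a + b)"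
  using assms hnth_mult_low[of a f b g] by (auto simp: hord_def)

definition hmonom :: "'a::zero \<Rightarrow> nat \<Rightarrow> 'a hurwitz" where
  "hmonom c m = Hurwitz (\<lambda>i. if i = m then c else 0)"

lemma hnth_hmonom: "hnth (hmonom c m) i = (if i = m then c else 0)"
  by (simp add: hmonom_def)

lemma hmonom_mult:
  "hmonom a k * hmonom b l = hmonom (of_nat (k + l choose l) * a * b :: 'a::comm_ring_1) (k + l)"
proof (rule hurwitz_eqI)
  fix i
  have "hnth (hmonom a k * hmonom b l) i =
      (\<Sum>j\<le>i. if j = l then of_nat (i choose l) * hnth (hmonom a k) (i - l) * b else 0)"
    unfolding hnth_mult by (intro sum.cong) (auto simp: hnth_hmonom)
  also have "\<dots> = hnth (hmonom (of_nat (k + l choose l) * a * b) (k + l)) i"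
    by (auto simp: hnth_hmonom)
  finally show "hnth (hmonom a k * hmonom b l) i = \<dots>" .
qed

lemma hderiv_hmonom_Suc: "hderiv (hmonom c (Suc m)) = hmonom c m"
  by (rule hurwitz_eqI) (simp add: hnth_hmonom)

section \<open>Binomial coefficients modulo a prime\<close>

text \<open>Since \<open>p ^ k\<close> divides \<open>j * (p ^ k choose j)\<close>, a binomial
  coefficient prime to p would force \<open>p ^ k\<close> to divide j.\<close>

lemma prime_dvd_choose_prime_power:
  fixes p :: nat
  assumes "prime p" "0 < j" "j < p ^ k"
  shows "p dvd (p ^ k choose j)"
proof (rule ccontr)
  assume "\<not> p dvd (p ^ k choose j)"
  then have "coprime (p ^ k) (p ^ k choose j)"
    using assms(1) by (simp add: prime_imp_coprime)
  moreover have "p ^ k dvd j * (p ^ k choose j)"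
    using assms(2) by (simp add: times_binomial_minus1_eq)
  ultimately have "p ^ k dvd j"
    by (simp add: coprime_dvd_mult_left_iff)
  then show False using assms by (auto dest: dvd_imp_le)
qed

text \<open>
  The polynomial \<open>((x + y)\<^sup>p - x\<^sup>p - y\<^sup>p) / p\<close>, whose coefficients are integers.
\<close>

definition frob_cocycle :: "nat \<Rightarrow> 'a::comm_ring_1 \<Rightarrow> 'a \<Rightarrow> 'a" where
  "frob_cocycle p x y = (\<Sum>j=1..<p. of_nat ((p choose j) div p) * (x ^ j * y ^ (p - j)))"

context
  fixes p :: nat
  assumes p: "prime p" "CHAR('k::field) = p"
begin

text \<open>A case of Lucas' theorem: in Vandermonde's convolution for \<open>q + q * m\<close> with
  \<open>q = p ^ k\<close>, only the two end terms survive modulo p.\<close>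

lemma of_nat_choose_prime_power_mult:
  "of_nat (p ^ k * m choose p ^ k) = (of_nat m :: 'k)"
proof (induction m)
  case 0
  have "p ^ k > 0" using p(1) by (simp add: prime_gt_0_nat)
  then show ?case by (simp add: binomial_eq_0)
next
  case (Suc m)
  define q where "q = p ^ k"
  have q: "q > 0" using p(1) by (simp add: q_def prime_gt_0_nat)
  have "(q * Suc m choose q) = (\<Sum>j\<le>q. (q choose j) * (q * m choose (q - j)))"
    using vandermonde[of q "q * m" q] by simp
  also have "of_nat \<dots> = (\<Sum>j\<le>q. if j = 0 then of_nat (q * m choose q) else if j = q then 1 else (0 :: 'k))"
    unfolding of_nat_sum
  proof (intro sum.cong refl)
    fix j assume "j \<in> {..q}"
    moreover have "of_nat (q choose j) = (0 :: 'k)" if "0 < j" "j < q"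
      using prime_dvd_choose_prime_power[of p j k] that p
      by (simp add: of_nat_eq_0_iff_char_dvd q_def)
    ultimately show "of_nat ((q choose j) * (q * m choose (q - j))) =
        (if j = 0 then of_nat (q * m choose q) else if j = q then 1 else (0 :: 'k))"
      by auto
  qed
  also have "\<dots> = (\<Sum>j\<in>{0, q}. if j = 0 then of_nat (q * m choose q) else if j = q then 1 else (0 :: 'k))"
    by (rule sum.mono_neutral_right) auto
  also have "\<dots> = of_nat (Suc m)"
    using q Suc[folded q_def] by simp
  finally show ?case by (simp only: q_def)
qed

text \<open>Row \<open>p ^ k\<close> of Pascal's triangle vanishes between its ends, so neighbours
  in the row above it cancel.\<close>

lemma of_nat_choose_prime_power_minus_1:
  "j < p ^ k \<Longrightarrow> of_nat (p ^ k - 1 choose j) = ((- 1) ^ j :: 'k)"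
proof (induction j)
  case (Suc j)
  have "0 < p ^ k" using Suc.prems by linarith
  from choose_reduce_nat[OF this, of "Suc j"]
  have "(p ^ k choose Suc j) = (p ^ k - 1 choose j) + (p ^ k - 1 choose Suc j)"
    by simp
  moreover have "of_nat (p ^ k choose Suc j) = (0 :: 'k)"
    using prime_dvd_choose_prime_power[of p "Suc j" k] Suc.prems p
    by (simp add: of_nat_eq_0_iff_char_dvd)
  ultimately have "of_nat (p ^ k - 1 choose j) + of_nat (p ^ k - 1 choose Suc j) = (0 :: 'k)"
    by (metis of_nat_add)
  then show ?case
    using Suc by (simp add: eq_neg_iff_add_eq_0 add.commute)
qed simp

lemma of_nat_neq_0_below_CHAR: "0 < j \<Longrightarrow> j < p \<Longrightarrow> of_nat j \<noteq> (0 :: 'k)"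
  using p by (auto simp: of_nat_eq_0_iff_char_dvd dest: dvd_imp_le)

text \<open>With \<open>N = p ^ k * m\<close> and p not dividing m, the coefficient at
  \<open>p ^ k\<close> is m modulo p, hence nonzero. So this index cannot lie strictly between 0 and
  N.\<close>

lemma prime_power_if_all_choose_eq_0:
  assumes "N > 0" "\<And>j. 0 < j \<Longrightarrow> j < N \<Longrightarrow> of_nat (N choose j) = (0 :: 'k)"
  shows "\<exists>n. N = p ^ n"
proof -
  obtain k m where N: "N = p ^ k * m" and m: "\<not> p dvd m"
    using assms(1) p(1) by (metis multiplicity_decompose' not_prime_unit gr_implies_not0)
  have "m = 1"
  proof (rule ccontr)
    assume "m \<noteq> 1"
    then have "of_nat (N choose p ^ k) = (0 :: 'k)"
      using assms N p by (intro assms(2)) (auto simp: prime_gt_0_nat)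
    then show False
      using m p by (simp add: N of_nat_choose_prime_power_mult of_nat_eq_0_iff_char_dvd)
  qed
  then show ?thesis using N by auto
qed

section \<open>Powers of series of order \<open>p ^ m\<close>\<close>

lemma hord_power:
  assumes "hord (f :: 'k hurwitz) (p ^ m)" "j < p"
  shows "hord (f ^ j) (p ^ m * j)"
  using assms(2)
proof (induction j)
  case 0
  then show ?case by (simp add: hord_def hnth_1)
next
  case (Suc j)
  \<comment> \<open>Each new factor contributes the scalar \<open>Suc j\<close>, invertible as long
    as the exponent stays below p.\<close>
  have "of_nat (p ^ m * Suc j choose p ^ m) \<noteq> (0 :: 'k)"
    unfolding of_nat_choose_prime_power_mult using Suc.prems by (intro of_nat_neq_0_below_CHAR) auto
  then have "hord (f ^ j * f) (p ^ m * j + p ^ m)"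
    using Suc assms(1) by (intro hord_mult) (auto simp: add.commute)
  then show ?case by (simp add: ac_simps)
qed

lemma choose_top_neq_0:
  "p ^ m * (p - 1) + (p ^ m - 1) = p ^ Suc m - 1"
  "of_nat (p ^ m * (p - 1) + (p ^ m - 1) choose (p ^ m - 1)) \<noteq> (0 :: 'k)"
proof -
  have gt: "p ^ m > 0" "p > 1" using p(1) by (simp_all add: prime_gt_0_nat prime_gt_Suc_0_nat)
  then have "p ^ m * (p - 1) + p ^ m = p ^ Suc m"
    by (cases p) auto
  then show eq: "p ^ m * (p - 1) + (p ^ m - 1) = p ^ Suc m - 1"
    using gt by linarith
  have "p ^ m - 1 < p ^ Suc m" using gt by (simp add: less_imp_diff_less)
  then show "of_nat (p ^ m * (p - 1) + (p ^ m - 1) choose (p ^ m - 1)) \<noteq> (0 :: 'k)"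
    unfolding eq by (subst of_nat_choose_prime_power_minus_1) auto
qed

text \<open>The order is one less than the next power of p, so an antiderivative without constant
  term has order \<open>p ^ Suc m\<close>.\<close>

lemma hord_power_deriv:
  assumes "hord (f :: 'k hurwitz) (p ^ m)"
  shows "hord (f ^ (p - 1) * hderiv f) (p ^ Suc m - 1)"
proof -
  have gt: "p ^ m > 0" "p > 1" using p(1) by (simp_all add: prime_gt_0_nat prime_gt_Suc_0_nat)
  have "hord (hderiv f) (p ^ m - 1)"
    using assms gt by (auto simp: hord_def)
  then have "hord (f ^ (p - 1) * hderiv f) (p ^ m * (p - 1) + (p ^ m - 1))"
    using gt choose_top_neq_0(2)
    by (intro hord_mult hord_power assms) auto
  then show ?thesis unfolding choose_top_neq_0(1) .
qed

lemma hmonom_power: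
  assumes "a \<noteq> 0" "j < p"
  shows "\<exists>b\<noteq>0. hmonom (a :: 'k) (p ^ m) ^ j = hmonom b (p ^ m * j)"
  using assms(2)
proof (induction j)
  case 0
  then show ?case by (auto simp: hmonom_def one_hurwitz_def intro!: exI[of _ 1])
next
  case (Suc j)
  then obtain b where b: "b \<noteq> 0" "hmonom a (p ^ m) ^ j = hmonom b (p ^ m * j)" by auto
  have "of_nat (p ^ m * Suc j choose p ^ m) \<noteq> (0 :: 'k)"
    unfolding of_nat_choose_prime_power_mult using Suc.prems by (intro of_nat_neq_0_below_CHAR) auto
  moreover have "hmonom a (p ^ m) ^ Suc j =
      hmonom (of_nat (p ^ m * Suc j choose p ^ m) * b * a) (p ^ m * Suc j)"
    using b by (simp add: power_Suc2 hmonom_mult add.commute del: power_Suc)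
  ultimately show ?case using b assms(1) by (metis mult_eq_0_iff)
qed

lemma hmonom_power_deriv:
  assumes "a \<noteq> 0"
  shows "\<exists>b\<noteq>0. hmonom (a :: 'k) (p ^ m) ^ (p - 1) * hderiv (hmonom a (p ^ m)) =
    hmonom b (p ^ Suc m - 1)"
proof -
  have gt: "p ^ m > 0" "p > 1" using p(1) by (simp_all add: prime_gt_0_nat prime_gt_Suc_0_nat)
  obtain b where b: "b \<noteq> 0" "hmonom a (p ^ m) ^ (p - 1) = hmonom b (p ^ m * (p - 1))"
    using hmonom_power[OF assms, of "p - 1" m] gt by auto
  have "hderiv (hmonom a (p ^ m)) = hmonom a (p ^ m - 1)"
    using gt hderiv_hmonom_Suc[of a "p ^ m - 1"] by simp
  then show ?thesis
    using b assms choose_top_neq_0[of m]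
    by (intro exI[of _ "of_nat (p ^ Suc m - 1 choose (p ^ m - 1)) * b * a"])
      (simp add: hmonom_mult del: power_Suc)
qed

text \<open>Formally \<open>f ^ (p - 1) * hderiv f\<close> is the derivative of
  \<open>f ^ p / p\<close>, so its failure to be additive is the derivative of the cocycle. As p is
  not invertible, the identity is verified on integer coefficients.\<close>

lemma hderiv_frob_cocycle:
  fixes x y :: "'k hurwitz"
  shows "(x + y) ^ (p - 1) * hderiv (x + y) =
    x ^ (p - 1) * hderiv x + y ^ (p - 1) * hderiv y + hderiv (frob_cocycle p x y)"
proof -
  have p1: "p > 1" using p(1) by (simp add: prime_gt_Suc_0_nat)
  then obtain r where r: "p = Suc r" "r > 0" by (cases p) auto
  define c where "c j = (p choose j) div p" for j
  have c: "c j * p = (p choose j)" if "0 < j" "j < p" for j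
    using that p prime_dvd_choose_prime_power[of p j 1] by (simp add: c_def)
  \<comment> \<open>Differentiating the two factors of term j multiplies its coefficient by j and by
    \<open>p - j\<close>; both results are entries of row \<open>p - 1\<close>.\<close>
  have cj: "c j * j = (r choose (j - 1))" "c j * (p - j) = (r choose j)" if j: "0 < j" "j < p" for j
  proof -
    have "p * (c j * j) = j * (c j * p)" by (simp add: ac_simps)
    also have "\<dots> = p * (r choose (j - 1))"
      unfolding c[OF j] using times_binomial_minus1_eq[of j p] j r by simp
    finally have "p * (c j * j) = p * (r choose (j - 1))" .
    with p1 show 1: "c j * j = (r choose (j - 1))" by simp
    have "c j * j + c j * (p - j) = c j * p" using j by (simp flip: distrib_left)
    also have "\<dots> = (r choose (j - 1)) + (r choose j)"
      using c[OF j] j binomial_Suc_Suc[of r "j - 1"] r by simp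
    finally show "c j * (p - j) = (r choose j)" using 1 by simp
  qed
  have "hderiv (frob_cocycle p x y) = (\<Sum>j=1..<p. of_nat (c j * j) * (x ^ (j - 1) * y ^ (p - j)) * hderiv x +
      of_nat (c j * (p - j)) * (x ^ j * y ^ (p - j - 1)) * hderiv y)"
    unfolding frob_cocycle_def hderiv_sum c_def[symmetric]
  proof (intro sum.cong refl)
    fix j
    have "hderiv (of_nat (c j) * (x ^ j * y ^ (p - j))) = of_nat (c j) * hderiv (x ^ j * y ^ (p - j))"
      by (simp add: hderiv_hconst_mult flip: hconst_of_nat)
    note d = this
    show "hderiv (of_nat (c j) * (x ^ j * y ^ (p - j))) =
      of_nat (c j * j) * (x ^ (j - 1) * y ^ (p - j)) * hderiv x +
      of_nat (c j * (p - j)) * (x ^ j * y ^ (p - j - 1)) * hderiv y"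
      unfolding d unfolding hderiv_mult hderiv_power by (simp add: distrib_left mult_ac)
  qed
  also have "\<dots> = (\<Sum>j=1..<p. of_nat (r choose (j - 1)) * (x ^ (j - 1) * y ^ (p - j))) * hderiv x +
      (\<Sum>j=1..<p. of_nat (r choose j) * (x ^ j * y ^ (r - j))) * hderiv y"
    unfolding sum.distrib sum_distrib_right
    by (intro arg_cong2[of _ _ _ _ "(+)"] sum.cong refl) (use cj r in auto)
  also have "(\<Sum>j=1..<p. of_nat (r choose (j - 1)) * (x ^ (j - 1) * y ^ (p - j))) =
      (\<Sum>j<r. of_nat (r choose j) * x ^ j * y ^ (r - j))"
    by (rule sum.reindex_bij_witness[of _ Suc "\<lambda>j. j - 1"]) (use r in \<open>auto simp: mult.assoc\<close>)
  also have "(\<Sum>j=1..<p. of_nat (r choose j) * (x ^ j * y ^ (r - j))) =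
      (\<Sum>j\<in>{1..r}. of_nat (r choose j) * x ^ j * y ^ (r - j))"
    by (intro sum.cong) (use r in \<open>auto simp: mult.assoc\<close>)
  \<comment> \<open>Both sums are the binomial expansion of \<open>(x + y) ^ r\<close> with one end
    term missing.\<close>
  also have "(\<Sum>j<r. of_nat (r choose j) * x ^ j * y ^ (r - j)) = (x + y) ^ r - x ^ r"
    unfolding binomial_ring by (simp flip: lessThan_Suc_atMost)
  also have "(\<Sum>j\<in>{1..r}. of_nat (r choose j) * x ^ j * y ^ (r - j)) = (x + y) ^ r - y ^ r"
  proof -
    have "{..r} = insert 0 {1..r}" by auto
    then show ?thesis unfolding binomial_ring by simp
  qed
  finally show ?thesis
    using r by (simp add: hderiv_add algebra_simps)
qed

end

section \<open>Differential subalgebras of divided power series\<close>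

definition twist :: "'a::comm_ring_1 hurwitz \<Rightarrow> 'a hurwitz \<Rightarrow> 'a hurwitz" where
  "twist u f = u * hderiv f"

text \<open>The Taylor series at the origin for the derivation \<open>u * hderiv\<close>: a ring
  homomorphism that turns this derivation into \<open>hderiv\<close>.\<close>

definition taylor :: "'a::comm_ring_1 hurwitz \<Rightarrow> 'a hurwitz \<Rightarrow> 'a hurwitz" where
  "taylor u f = Hurwitz (\<lambda>i. hnth ((twist u ^^ i) f) 0)"

lemma hnth_taylor_0 [simp]: "hnth (taylor u f) 0 = hnth f 0"
  by (simp add: taylor_def)

lemma hderiv_taylor: "hderiv (taylor u f) = taylor u (twist u f)"
  by (rule hurwitz_eqI) (simp add: taylor_def funpow_swap1)

lemma twist_mult: "twist u (f * g) = twist u f * g + f * twist u g"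
  by (simp add: twist_def hderiv_mult algebra_simps)

lemma taylor_add: "taylor u (f + g) = taylor u f + taylor u g"
proof -
  have "(twist u ^^ i) (f + g) = (twist u ^^ i) f + (twist u ^^ i) g" for i
    by (induction i) (simp_all add: twist_def hderiv_add algebra_simps)
  then show ?thesis by (intro hurwitz_eqI) (simp add: taylor_def)
qed

lemma taylor_mult: "taylor u (f * g) = taylor u f * taylor u g"
proof -
  have "hnth (taylor u (f * g)) i = hnth (taylor u f * taylor u g) i" for i
  proof (induction i arbitrary: f g)
    case (Suc i)
    have "hnth (taylor u (f * g)) (Suc i) = hnth (taylor u (twist u f * g + f * twist u g)) i"
      by (simp flip: hnth_hderiv add: hderiv_taylor twist_mult)
    then show ?case
      by (simp add: taylor_add Suc hnth_mult_Suc hderiv_taylor)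
  qed simp
  then show ?thesis by (rule hurwitz_eqI)
qed

lemma taylor_0 [simp]: "taylor u 0 = 0"
  using taylor_add[of u 0 0] by simp

lemma taylor_hconst [simp]: "taylor u (hconst c) = hconst c"
  by (subst hderiv_eq_iff) (simp add: hderiv_taylor twist_def)

lemma taylor_1 [simp]: "taylor u 1 = 1"
  using taylor_hconst[of u 1] by simp

lemma taylor_power: "taylor u (f ^ n) = taylor u f ^ n"
  by (induction n) (simp_all add: taylor_mult)

lemma taylor_diff: "taylor u (f - g) = taylor u f - taylor u g"
  by (metis add_diff_cancel_right' diff_add_cancel taylor_add)

lemma taylor_sum: "taylor u (sum f S) = (\<Sum>i\<in>S. taylor u (f i))"
  by (induction S rule: infinite_finite_induct) (simp_all add: taylor_add)

lemma hnth_funpow_hderiv: "hnth ((hderiv ^^ k) f) j = hnth f (j + k)"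
  by (induction k arbitrary: j) simp_all

lemma hurwitz_power_CHAR_eq_0: "(f :: 'a::comm_ring_1 hurwitz) ^ CHAR('a) = 0"
  if "hnth f 0 = 0" "CHAR('a) > 0"
  using that by (simp add: hurwitz_power_CHAR zero_power)

text \<open>The assumption \<open>separated\<close> expresses finite dimension: boundedly many
  coefficients determine an element. Algebraic closedness of the scalars supplies p-th
  roots.\<close>

locale hurwitz_subalgebra =
  fixes A :: "'k::alg_closed_field hurwitz set" and p :: nat
  assumes prime: "prime p" and char: "CHAR('k) = p"
    and one_mem: "1 \<in> A"
    and add_mem: "f \<in> A \<Longrightarrow> g \<in> A \<Longrightarrow> f + g \<in> A"
    and mult_mem: "f \<in> A \<Longrightarrow> g \<in> A \<Longrightarrow> f * g \<in> A"
    and hconst_mult_mem: "f \<in> A \<Longrightarrow> hconst c * f \<in> A"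
    and hderiv_mem: "f \<in> A \<Longrightarrow> hderiv f \<in> A"
    and separated: "\<exists>N. \<forall>f\<in>A. (\<forall>i<N. hnth f i = 0) \<longrightarrow> f = 0"
begin

lemma p_gt_1: "p > 1"
  using prime by (simp add: prime_gt_Suc_0_nat)

lemma hconst_mem: "hconst c \<in> A"
  using hconst_mult_mem[OF one_mem, of c] by simp

lemma zero_mem: "0 \<in> A"
  using hconst_mem[of 0] by simp

lemma minus_mem: "f \<in> A \<Longrightarrow> - f \<in> A"
  using hconst_mult_mem[of f "-1"] by (simp add: hconst_minus)

lemma diff_mem: "f \<in> A \<Longrightarrow> g \<in> A \<Longrightarrow> f - g \<in> A"
  using add_mem[of f "- g"] minus_mem by simp

lemma power_mem: "f \<in> A \<Longrightarrow> f ^ n \<in> A"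
  by (induction n) (simp_all add: one_mem mult_mem)

lemma sum_mem: "(\<And>i. i \<in> S \<Longrightarrow> f i \<in> A) \<Longrightarrow> sum f S \<in> A"
  by (induction S rule: infinite_finite_induct) (simp_all add: zero_mem add_mem)

lemma funpow_hderiv_mem: "f \<in> A \<Longrightarrow> (hderiv ^^ k) f \<in> A"
  by (induction k) (simp_all add: hderiv_mem)

section \<open>Orders of elements and the dimension count\<close>

definition height :: nat where
  "height = (LEAST N. \<forall>f\<in>A. (\<forall>i<N. hnth f i = 0) \<longrightarrow> f = 0)"

lemma eq_0_if_low_eq_0: "f \<in> A \<Longrightarrow> (\<And>i. i < height \<Longrightarrow> hnth f i = 0) \<Longrightarrow> f = 0"
  using LeastI_ex[OF separated] unfolding height_def by blast

text \<open>Minimality of \<open>height\<close> gives a nonzero element vanishing below i, and each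
  derivative lowers its order by one.\<close>

lemma ex_hord:
  assumes "i < height"
  shows "\<exists>b\<in>A. hord b i"
proof -
  obtain f where f: "f \<in> A" "\<forall>j<i. hnth f j = 0" "f \<noteq> 0"
    using not_less_Least[OF assms[unfolded height_def]] by blast
  obtain m where m: "hnth f m \<noteq> 0" "\<forall>j<m. hnth f j = 0"
  proof -
    have "\<exists>m. hnth f m \<noteq> 0" using f(3) hurwitz_eqI[of f 0] by auto
    then show ?thesis
      using that LeastI_ex[of "\<lambda>m. hnth f m \<noteq> 0"] not_less_Least by blast
  qed
  have "i \<le> m" using f(2) m(1) by (meson not_le_imp_less)
  then have "hord ((hderiv ^^ (m - i)) f) i"
    using m by (auto simp: hord_def hnth_funpow_hderiv)
  then show ?thesis using funpow_hderiv_mem[OF f(1)] by blast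
qed

lemma hord_less_height: "f \<in> A \<Longrightarrow> hord f m \<Longrightarrow> m < height"
  using eq_0_if_low_eq_0[of f] by (force simp: hord_def not_less)

text \<open>Triangular solving: an element of order m corrects coefficient m without disturbing the
  earlier ones.\<close>

lemma ex_prescribed:
  assumes "m \<le> height"
  shows "\<exists>h\<in>A. \<forall>i<m. hnth h i = t i"
  using assms
proof (induction m)
  case 0
  then show ?case using zero_mem by auto
next
  case (Suc m)
  then obtain h where h: "h \<in> A" "\<forall>i<m. hnth h i = t i" by auto
  obtain b where b: "b \<in> A" "hord b m" using ex_hord[of m] Suc.prems by auto
  have "h + hconst ((t m - hnth h m) / hnth b m) * b \<in> A"
    using h b by (intro add_mem hconst_mult_mem)
  moreover have "\<forall>i<Suc m. hnth (h + hconst ((t m - hnth h m) / hnth b m) * b) i = t i"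
    using h b by (auto simp: hord_def less_Suc_eq)
  ultimately show ?case by blast
qed

lemma height_pos: "height > 0"
  by (rule ccontr) (use eq_0_if_low_eq_0[OF one_mem] in auto)

text \<open>Elements of orders \<open>height - j\<close> and \<open>j\<close> have a product
  vanishing below \<open>height\<close>, hence zero; but its coefficient at \<open>height\<close> is
  \<open>height choose j\<close> times a nonzero scalar.\<close>

lemma height_prime_power: "\<exists>n. height = p ^ n"
proof (rule prime_power_if_all_choose_eq_0[OF prime char height_pos])
  fix j assume j: "0 < j" "j < height"
  obtain f where f: "f \<in> A" "hord f (height - j)" using ex_hord[of "height - j"] j by auto
  obtain g where g: "g \<in> A" "hord g j" using ex_hord[of j] j by auto
  have "f * g = 0"
    using f g j hnth_mult_low(1)[of "height - j" f j g]
    by (intro eq_0_if_low_eq_0 mult_mem) (auto simp: hord_def)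
  then show "of_nat (height choose j) = (0 :: 'k)"
    using f g j hnth_mult_low(2)[of "height - j" f j g] by (auto simp: hord_def)
qed

definition exponent :: nat where
  "exponent = (SOME n. height = p ^ n)"

lemma height_eq: "height = p ^ exponent"
  unfolding exponent_def by (rule someI_ex[OF height_prime_power])

section \<open>Integration inside the subalgebra\<close>

lemma hderiv_codim_1:
  assumes "f \<in> A" "g \<in> A"
  shows "\<exists>a b h. (a \<noteq> 0 \<or> b \<noteq> 0) \<and> h \<in> A \<and> hconst a * f + hconst b * g = hderiv h"
proof -
  \<comment> \<open>All coefficients of a derivative below \<open>height - 1\<close> can be
    prescribed. The one at \<open>height - 1\<close> is the only obstruction, so the cokernel of
    \<open>hderiv\<close> has dimension at most one.\<close>
  have *: "\<exists>h\<in>A. \<forall>i<height - 1. hnth (hderiv h) i = hnth f i" if "f \<in> A" for f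
    using ex_prescribed[of height "\<lambda>i. hnth f (i - 1)"] by (force simp: less_diff_conv)
  obtain h1 h2 where h: "h1 \<in> A" "\<forall>i<height - 1. hnth (hderiv h1) i = hnth f i"
      "h2 \<in> A" "\<forall>i<height - 1. hnth (hderiv h2) i = hnth g i"
    using * assms by meson
  define a' where "a' = hnth (f - hderiv h1) (height - 1)"
  define b' where "b' = hnth (g - hderiv h2) (height - 1)"
  \<comment> \<open>A nontrivial solution of \<open>a * a' + b * b' = 0\<close>, also when both
    obstructions vanish.\<close>
  define a where "a = (if a' = 0 then 1 else b')"
  define b where "b = (if a' = 0 then 0 else - a')"
  define h where "h = hconst a * h1 + hconst b * h2"
  have "hconst a * f + hconst b * g - hderiv h = 0"
  proof (rule eq_0_if_low_eq_0)
    show "hconst a * f + hconst b * g - hderiv h \<in> A"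
      unfolding h_def using assms h(1,3) by (intro diff_mem add_mem hconst_mult_mem hderiv_mem)
    fix i assume "i < height"
    then consider "i < height - 1" | "i = height - 1" by linarith
    then show "hnth (hconst a * f + hconst b * g - hderiv h) i = 0"
    proof cases
      case 1
      then show ?thesis using h by (simp add: h_def flip: hnth_hderiv add: hderiv_add hderiv_hconst_mult)
    next
      case 2
      have "hnth (hconst a * f + hconst b * g - hderiv h) i = a * a' + b * b'"
        by (simp add: 2 h_def a'_def b'_def hderiv_add hderiv_hconst_mult del: hnth_hderiv)
          (simp add: algebra_simps)
      then show ?thesis by (simp add: a_def b_def)
    qed
  qed
  moreover have "h \<in> A" unfolding h_def using h(1,3) by (intro add_mem hconst_mult_mem)
  moreover have "a \<noteq> 0 \<or> b \<noteq> 0" by (simp add: a_def b_def)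
  ultimately show ?thesis by (intro exI[of _ a] exI[of _ b] exI[of _ h]) simp
qed

text \<open>
  The set of \<open>f\<close> from which the recursion \<open>f \<mapsto> \<integral> f\<^sup>p\<^sup>-\<^sup>1 hderiv f\<close> can be iterated \<open>i\<close> times
  inside \<open>A\<close>.
\<close>

fun chain :: "nat \<Rightarrow> 'k hurwitz set" where
  "chain 0 = {f \<in> A. hnth f 0 = 0}"
| "chain (Suc i) = {f \<in> A. hnth f 0 = 0 \<and> (\<exists>g\<in>chain i. hderiv g = f ^ (p - 1) * hderiv f)}"

lemma chain_SucI:
  "f \<in> A \<Longrightarrow> hnth f 0 = 0 \<Longrightarrow> g \<in> chain i \<Longrightarrow> hderiv g = f ^ (p - 1) * hderiv f
    \<Longrightarrow> f \<in> chain (Suc i)"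
  by auto

lemma chain_mem: "f \<in> chain i \<Longrightarrow> f \<in> A" "f \<in> chain i \<Longrightarrow> hnth f 0 = 0"
  by (cases i; simp)+

lemma power_p_eq_0: "hnth f 0 = 0 \<Longrightarrow> f ^ p = (0 :: 'k hurwitz)"
  using hurwitz_power_CHAR_eq_0[of f] char p_gt_1 by simp

lemma hconst_mult_power_deriv:
  "(hconst c * f) ^ (p - 1) * hderiv (hconst c * f) = hconst (c ^ p) * (f ^ (p - 1) * hderiv f)"
  for f :: "'k hurwitz"
proof -
  have "(hconst c * f) ^ (p - 1) * hderiv (hconst c * f) =
      (hconst c * hconst c ^ (p - 1)) * (f ^ (p - 1) * hderiv f)"
    unfolding power_mult_distrib hderiv_hconst_mult by (simp only: mult_ac)
  also have "hconst c * hconst c ^ (p - 1) = hconst (c ^ p)"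
    unfolding power_Suc[symmetric] using p_gt_1 by (simp add: hconst_power del: power_Suc)
  finally show ?thesis .
qed

lemma zero_mem_chain: "0 \<in> chain i"
proof (induction i)
  case (Suc i)
  then show ?case using zero_mem by (auto intro!: bexI[of _ 0])
qed (simp add: zero_mem)

text \<open>By Leibniz' rule every term of \<open>(f * g) ^ (p - 1) * hderiv (f * g)\<close>
  contains \<open>f ^ p\<close> or \<open>g ^ p\<close>, which are zero; so the chain continues with
  0.\<close>

lemma mult_mem_chain:
  assumes "f \<in> A" "g \<in> A" "hnth f 0 = 0" "hnth g 0 = 0"
  shows "f * g \<in> chain i"
proof (cases i)
  case (Suc j)
  have "(f * g) ^ (p - 1) * hderiv (f * g) = f ^ Suc (p - 1) * (g ^ (p - 1) * hderiv g)
      + g ^ Suc (p - 1) * (f ^ (p - 1) * hderiv f)"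
    by (simp add: hderiv_mult power_mult_distrib algebra_simps)
  also have "\<dots> = 0" using assms p_gt_1 by (simp del: power_Suc add: power_p_eq_0)
  finally have "hderiv 0 = (f * g) ^ (p - 1) * hderiv (f * g)" by simp
  then show ?thesis
    using assms mult_mem zero_mem_chain[of j] by (auto simp only: Suc chain.simps mem_Collect_eq hnth_mult_0 mult_zero_left)
qed (use assms mult_mem in simp)

lemma hconst_mult_mem_chain:
  "f \<in> chain i \<Longrightarrow> hconst c * f \<in> chain i"
proof (induction i arbitrary: f c)
  case (Suc i)
  then obtain g where g: "f \<in> A" "hnth f 0 = 0" "g \<in> chain i" "hderiv g = f ^ (p - 1) * hderiv f"
    by auto
  have "hderiv (hconst (c ^ p) * g) = (hconst c * f) ^ (p - 1) * hderiv (hconst c * f)"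
    unfolding hconst_mult_power_deriv by (simp add: hderiv_hconst_mult g)
  then show ?case using g Suc.IH[OF g(3)] hconst_mult_mem by auto
qed (simp add: hconst_mult_mem)

text \<open>Both exponents in each term of the cocycle are positive, so
  \<open>mult_mem_chain\<close> applies. Additivity of \<open>chain i\<close> is assumed because the
  lemma serves inside the induction that proves it.\<close>

lemma frob_cocycle_mem:
  assumes "\<And>f g. f \<in> chain i \<Longrightarrow> g \<in> chain i \<Longrightarrow> f + g \<in> chain i"
    and "f \<in> A" "g \<in> A" "hnth f 0 = 0" "hnth g 0 = 0"
  shows "frob_cocycle p f g \<in> chain i"
proof -
  have sum: "sum F S \<in> chain i" if "\<And>j. j \<in> S \<Longrightarrow> F j \<in> chain i" for F and S :: "nat set"
    using that by (induction S rule: infinite_finite_induct) (auto simp: zero_mem_chain assms(1))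
  show ?thesis
    unfolding frob_cocycle_def using assms(2-)
    by (intro sum) (auto simp: hconst_mult_mem_chain mult_mem_chain power_mem hnth_power_0
      simp flip: hconst_of_nat)
qed

lemma add_mem_chain:
  "f \<in> chain i \<Longrightarrow> g \<in> chain i \<Longrightarrow> f + g \<in> chain i"
proof (induction i arbitrary: f g)
  case (Suc i)
  then obtain f' g' where f: "f \<in> A" "hnth f 0 = 0" "f' \<in> chain i" "hderiv f' = f ^ (p - 1) * hderiv f"
    and g: "g \<in> A" "hnth g 0 = 0" "g' \<in> chain i" "hderiv g' = g ^ (p - 1) * hderiv g"
    by auto
  have "f' + g' + frob_cocycle p f g \<in> chain i"
    by (intro Suc.IH f g frob_cocycle_mem)
  moreover have "hderiv (f' + g' + frob_cocycle p f g) = (f + g) ^ (p - 1) * hderiv (f + g)"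
    unfolding hderiv_frob_cocycle[OF prime char] by (simp add: f g hderiv_add)
  ultimately show ?case using f(1,2) g(1,2) add_mem by auto
qed (simp add: add_mem)

text \<open>The obstruction to one more step is Frobenius-semilinear with values in a space of
  dimension at most one, so two elements have a combination on which it vanishes. The induction
  passes to the antiderivatives.\<close>

lemma ex_combination_mem_chain_Suc:
  "f \<in> chain i \<Longrightarrow> g \<in> chain i \<Longrightarrow>
    \<exists>a b. (a \<noteq> 0 \<or> b \<noteq> 0) \<and> hconst a * f + hconst b * g \<in> chain (Suc i)"
proof (induction i arbitrary: f g)
  case 0
  then have fg: "f \<in> A" "hnth f 0 = 0" "g \<in> A" "hnth g 0 = 0" by auto
  obtain a b h where ab: "a \<noteq> 0 \<or> b \<noteq> 0" and h: "h \<in> A"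
    "hconst a * (f ^ (p - 1) * hderiv f) + hconst b * (g ^ (p - 1) * hderiv g) = hderiv h"
    using hderiv_codim_1[of "f ^ (p - 1) * hderiv f" "g ^ (p - 1) * hderiv g"] fg
    by (auto simp: mult_mem power_mem hderiv_mem)
  have "p > 0" using p_gt_1 by simp
  \<comment> \<open>Scaling f by s scales \<open>f ^ (p - 1) * hderiv f\<close> by
    \<open>s ^ p\<close>, hence the p-th roots.\<close>
  then obtain s t where st: "s ^ p = a" "t ^ p = b" by (meson nth_root_exists)
  define F where "F = hconst s * f"
  define G where "G = hconst t * g"
  have FG: "F \<in> A" "G \<in> A" "hnth F 0 = 0" "hnth G 0 = 0"
    using fg by (auto simp: F_def G_def hconst_mult_mem)
  define k where "k = h + frob_cocycle p F G"
  have k: "k \<in> A"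
    using h(1) frob_cocycle_mem[of 0 F G] FG by (auto simp: k_def intro: add_mem)
  have "hderiv k = (F + G) ^ (p - 1) * hderiv (F + G)"
    unfolding hderiv_frob_cocycle[OF prime char] k_def F_def G_def hconst_mult_power_deriv st
    by (simp add: hderiv_add h(2)[symmetric])
  then have "hderiv (k - hconst (hnth k 0)) = (F + G) ^ (p - 1) * hderiv (F + G)"
    by (simp add: hderiv_diff)
  moreover have "k - hconst (hnth k 0) \<in> chain 0"
    using k by (auto simp: diff_mem hconst_mem hnth_hconst)
  ultimately have "F + G \<in> chain (Suc 0)"
    using FG add_mem by (simp only: chain.simps) auto
  moreover have "s \<noteq> 0 \<or> t \<noteq> 0" using st ab \<open>p > 0\<close> by (auto simp: zero_power)
  ultimately show ?case unfolding F_def G_def by blast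
next
  case (Suc i)
  then obtain f' g' where f: "f \<in> A" "hnth f 0 = 0" "f' \<in> chain i" "hderiv f' = f ^ (p - 1) * hderiv f"
    and g: "g \<in> A" "hnth g 0 = 0" "g' \<in> chain i" "hderiv g' = g ^ (p - 1) * hderiv g"
    by auto
  obtain a b where ab: "a \<noteq> 0 \<or> b \<noteq> 0" "hconst a * f' + hconst b * g' \<in> chain (Suc i)"
    using Suc.IH[OF f(3) g(3)] by blast
  have "p > 0" using p_gt_1 by simp
  then obtain s t where st: "s ^ p = a" "t ^ p = b" by (meson nth_root_exists)
  define F where "F = hconst s * f"
  define G where "G = hconst t * g"
  have FG: "F \<in> A" "G \<in> A" "hnth F 0 = 0" "hnth G 0 = 0"
    using f g by (auto simp: F_def G_def hconst_mult_mem)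
  have "hderiv (hconst a * f' + hconst b * g' + frob_cocycle p F G) = (F + G) ^ (p - 1) * hderiv (F + G)"
    unfolding hderiv_frob_cocycle[OF prime char] F_def G_def hconst_mult_power_deriv st
    by (simp add: hderiv_add hderiv_hconst_mult f g)
  moreover have "hconst a * f' + hconst b * g' + frob_cocycle p F G \<in> chain (Suc i)"
    by (intro add_mem_chain frob_cocycle_mem FG ab(2))
  ultimately have "F + G \<in> chain (Suc (Suc i))"
    using FG by (intro chain_SucI[of "F + G"]) (simp_all add: add_mem)
  moreover have "s \<noteq> 0 \<or> t \<noteq> 0" using st ab(1) \<open>p > 0\<close> by (auto simp: zero_power)
  ultimately show ?case unfolding F_def G_def by blast
qed

lemma hord_lift:
  fixes f g :: "'k hurwitz"
  assumes "hord f (p ^ m)" "hderiv g = f ^ (p - 1) * hderiv f" "hnth g 0 = 0"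
  shows "hord g (p ^ Suc m)"
proof -
  have D: "hord (hderiv g) (p ^ Suc m - 1)"
    using hord_power_deriv[OF prime char assms(1)] assms(2) by simp
  have "hnth g i = 0" if "i < p ^ Suc m" for i
    using that D assms(3) by (cases i) (auto simp: hord_def less_diff_conv)
  moreover have "hnth g (p ^ Suc m) \<noteq> 0"
    using D p_gt_1 by (simp add: hord_def)
  ultimately show ?thesis by (simp add: hord_def)
qed

text \<open>Each link of a chain multiplies the order by p, and all orders stay below
  \<open>p ^ exponent\<close>.\<close>

lemma chain_hord_bound:
  "f \<in> chain i \<Longrightarrow> hord f (p ^ m) \<Longrightarrow> i + m < exponent"
proof (induction i arbitrary: f m)
  case 0
  then have "p ^ m < p ^ exponent" using hord_less_height[of f] by (simp add: height_eq)
  then show ?case using p_gt_1 by (simp add: power_strict_increasing_iff)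
next
  case (Suc i)
  then obtain g where g: "hnth f 0 = 0" "g \<in> chain i" "hderiv g = f ^ (p - 1) * hderiv f"
    by auto
  then have "hord g (p ^ Suc m)" using Suc.prems(2) chain_mem(2)[OF g(2)] by (intro hord_lift)
  from Suc.IH[OF g(2) this] show ?case by simp
qed

text \<open>Combine an element of order \<open>p ^ m\<close> with one of the largest possible order
  so that the result can be continued. The bound shows that the first one really occurs in it, and
  it determines the order.\<close>

lemma ex_chain_hord:
  "i + m < exponent \<Longrightarrow> \<exists>f\<in>chain i. hord f (p ^ m)"
proof (induction i arbitrary: m)
  case 0
  then have "p ^ m < height" unfolding height_eq using p_gt_1 by simp
  then obtain b where b: "b \<in> A" "hord b (p ^ m)" using ex_hord by blast
  moreover have "hnth b 0 = 0" using b(2) p_gt_1 by (simp add: hord_def)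
  ultimately show ?case by auto
next
  case (Suc i)
  obtain z where z: "z \<in> chain i" "hord z (p ^ m)" using Suc.IH[of m] Suc.prems by auto
  \<comment> \<open>The largest value the bound admits for \<open>chain i\<close>; in
    \<open>chain (Suc i)\<close> the order \<open>p ^ l\<close> is impossible.\<close>
  define l where "l = exponent - 1 - i"
  have l: "m < l" "i + l < exponent" using Suc.prems by (auto simp: l_def)
  obtain w where w: "w \<in> chain i" "hord w (p ^ l)" using Suc.IH[of l] l by auto
  obtain a b where ab: "a \<noteq> 0 \<or> b \<noteq> 0" "hconst a * z + hconst b * w \<in> chain (Suc i)"
    using ex_combination_mem_chain_Suc[OF z(1) w(1)] by blast
  have less: "p ^ m < p ^ l" using l p_gt_1 by simp
  have "a \<noteq> 0"
  proof
    assume "a = 0"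
    then have "hord (hconst a * z + hconst b * w) (p ^ l)"
      using w(2) ab(1) by (auto simp: hord_def)
    from chain_hord_bound[OF ab(2) this] show False by (simp add: l_def)
  qed
  then have "hord (hconst a * z + hconst b * w) (p ^ m)"
    using z(2) w(2) less by (auto simp: hord_def)
  then show ?case using ab(2) by blast
qed

text \<open>
  In terms of the derivation \<open>(D y)\<^sup>-\<^sup>1 D\<close> of a suitable \<open>y\<close>, the elements of a chain are, up to scalars, the divided powers
  \<open>y\<^sup>(\<^sup>p\<^sup>^\<^sup>i\<^sup>)\<close>.
\<close>

lemma taylor_chain:
  assumes "u \<in> A" "f \<in> chain i" "taylor u f = hmonom a (p ^ m)" "a \<noteq> 0"
  shows "\<exists>g\<in>A. \<exists>b\<noteq>0. taylor u g = hmonom b (p ^ Suc (m + i) - 1)"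
  using assms(2-)
proof (induction i arbitrary: f a m)
  case 0
  \<comment> \<open>The end of the chain is not integrated: \<open>f ^ (p - 1) * twist u f\<close>
    itself gives the monomial just below the next power of p.\<close>
  obtain b where "b \<noteq> 0" "hmonom a (p ^ m) ^ (p - 1) * hderiv (hmonom a (p ^ m)) = hmonom b (p ^ Suc m - 1)"
    using hmonom_power_deriv[OF prime char 0(3)] by blast
  moreover have "taylor u (f ^ (p - 1) * twist u f) = hmonom a (p ^ m) ^ (p - 1) * hderiv (hmonom a (p ^ m))"
    by (simp add: taylor_mult taylor_power 0(2) flip: hderiv_taylor)
  moreover have "f ^ (p - 1) * twist u f \<in> A"
    unfolding twist_def using chain_mem[OF 0(1)] assms(1) by (intro mult_mem power_mem hderiv_mem)
  ultimately show ?case by auto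
next
  case (Suc i)
  obtain g where g: "hnth f 0 = 0" "g \<in> chain i" "hderiv g = f ^ (p - 1) * hderiv f"
    using Suc.prems by auto
  obtain b where b: "b \<noteq> 0" "hmonom a (p ^ m) ^ (p - 1) * hderiv (hmonom a (p ^ m)) = hmonom b (p ^ Suc m - 1)"
    using hmonom_power_deriv[OF prime char Suc.prems(3)] by blast
  have "twist u g = f ^ (p - 1) * twist u f"
    by (simp add: twist_def g mult_ac)
  then have "hderiv (taylor u g) = hmonom b (p ^ Suc m - 1)"
    by (simp only: hderiv_taylor taylor_mult taylor_power Suc.prems(2) b flip: b(2))
      (simp add: Suc.prems(2) flip: hderiv_taylor)
  moreover have "p ^ Suc m > 0" using p_gt_1 by simp
  ultimately have "taylor u g = hmonom b (p ^ Suc m)"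
    using chain_mem(2)[OF g(2)] hderiv_hmonom_Suc[of b "p ^ Suc m - 1"]
    by (subst hderiv_eq_iff) (simp add: hnth_hmonom)
  from Suc.IH[OF g(2) this b(1)] show ?case by simp
qed

text \<open>A long chain starting in order 1 provides the top monomial in the image; differentiating
  it gives all lower ones. Since \<open>height\<close> coefficients determine an element, nothing
  else is left.\<close>

theorem ex_taylor_iso:
  "\<exists>u\<in>A. \<exists>v\<in>A. u * v = 1 \<and> bij_betw (taylor u) A {f. \<forall>i\<ge>p ^ exponent. hnth f i = 0}"
proof -
  have "\<exists>u\<in>A. \<exists>v\<in>A. u * v = 1 \<and> (\<exists>g\<in>A. \<exists>b\<noteq>0. taylor u g = hmonom b (p ^ exponent - 1))"
  proof (cases exponent)
    case 0
    have "taylor 1 1 = hmonom (1 :: 'k) (p ^ exponent - 1)"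
      by (simp add: 0 hmonom_def flip: one_hurwitz_def)
    then show ?thesis using one_mem by (metis mult_1 zero_neq_one)
  next
    case (Suc r)
    then obtain y where y: "y \<in> chain r" "hord y (p ^ 0)"
      using ex_chain_hord[of r 0] by auto
    define v where "v = hderiv y"
    have v: "v \<in> A" "hnth v 0 \<noteq> 0"
      using y chain_mem(1)[OF y(1)] by (auto simp: v_def hderiv_mem hord_def)
    \<comment> \<open>The power \<open>v ^ p\<close> is constant, so the inverse of v is a multiple
      of \<open>v ^ (p - 1)\<close> and lies in \<open>A\<close>.\<close>
    define c where "c = hnth v 0 ^ p"
    have c: "c \<noteq> 0" "v ^ p = hconst c"
      using v hurwitz_power_CHAR[of v] p_gt_1 char by (auto simp: c_def)
    define u where "u = hconst (1 / c) * v ^ (p - 1)"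
    have u: "u \<in> A" unfolding u_def using v by (intro hconst_mult_mem power_mem)
    have "u * v = hconst (1 / c) * v ^ p"
      using p_gt_1 power_Suc2[of v "p - 1"] by (simp add: u_def mult.assoc)
    also have "\<dots> = 1" using c by (simp flip: hconst_mult)
    finally have uv: "u * v = 1" .
    \<comment> \<open>The derivation \<open>twist u\<close> sends y to 1, because u is inverse to
      the derivative of y.\<close>
    have "taylor u y = hmonom 1 (p ^ 0)"
    proof (subst hderiv_eq_iff, intro conjI)
      show "hderiv (taylor u y) = hderiv (hmonom 1 (p ^ 0))"
        using uv hderiv_hmonom_Suc[of 1 0]
        by (simp add: hderiv_taylor twist_def flip: v_def) (simp add: hmonom_def one_hurwitz_def)
    qed (use chain_mem(2)[OF y(1)] in \<open>simp add: hnth_hmonom\<close>)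
    from taylor_chain[OF u y(1) this] show ?thesis using u v uv by (auto simp: Suc)
  qed
  then obtain u v g b where u: "u \<in> A" "v \<in> A" "u * v = 1"
    and g: "g \<in> A" "b \<noteq> 0" "taylor u g = hmonom b (p ^ exponent - 1)" by blast
  \<comment> \<open>The derivations \<open>twist u\<close> and \<open>hderiv\<close> differ by a
    unit, so vanishing of the first m coefficients passes from \<open>taylor u f\<close> back to
    f.\<close>
  have low: "hnth f i = 0" if "\<forall>i<m. hnth (taylor u f) i = 0" "i < m" for f i m
    using that
  proof (induction m arbitrary: f i)
    case (Suc m)
    have "\<forall>i<m. hnth (taylor u (twist u f)) i = 0"
      using Suc.prems(1) by (auto simp flip: hderiv_taylor)
    then have "\<And>i. i < m \<Longrightarrow> hnth (twist u f) i = 0" by (rule Suc.IH)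
    then have "hnth (v * twist u f) j = 0" if "j < m" for j
      using hnth_mult_low(1)[of 0 v m "twist u f" j] that by simp
    moreover have "v * twist u f = hderiv f"
      using u(3) by (simp add: twist_def mult_ac flip: mult.assoc)
    ultimately have "hnth f (Suc j) = 0" if "j < m" for j using that by simp
    moreover have "hnth f 0 = 0" using Suc.prems(1) by auto
    ultimately show ?case using Suc.prems(2) by (cases i) auto
  qed simp
  have twist_mem: "f \<in> A \<Longrightarrow> twist u f \<in> A" for f
    unfolding twist_def using u(1) by (intro mult_mem hderiv_mem)
  have monom: "\<exists>w\<in>A. taylor u w = hmonom 1 m" if "m < p ^ exponent" for m
  proof -
    have "\<exists>w\<in>A. taylor u w = hmonom b (p ^ exponent - 1 - j)" if "j < p ^ exponent" for j
      using that
    proof (induction j)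
      case 0
      then show ?case using g by auto
    next
      case (Suc j)
      then obtain w where w: "w \<in> A" "taylor u w = hmonom b (p ^ exponent - 1 - j)" by auto
      have "taylor u (twist u w) = hmonom b (p ^ exponent - 1 - Suc j)"
        using hderiv_hmonom_Suc[of b "p ^ exponent - 1 - Suc j"] Suc.prems
        by (simp add: w(2) Suc_diff_Suc flip: hderiv_taylor)
      then show ?case using twist_mem[OF w(1)] by blast
    qed
    moreover have "p ^ exponent - 1 - m < p ^ exponent" using that by linarith
    moreover have "p ^ exponent - 1 - (p ^ exponent - 1 - m) = m" using that by linarith
    ultimately obtain w where w: "w \<in> A" "taylor u w = hmonom b m"
      by metis
    have "taylor u (hconst (1 / b) * w) = hmonom 1 m"
      using g(2) by (intro hurwitz_eqI) (simp add: taylor_mult w(2) hnth_hmonom)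
    then show ?thesis using hconst_mult_mem[OF w(1)] by blast
  qed
  then obtain w where w: "\<And>m. m < p ^ exponent \<Longrightarrow> w m \<in> A"
      "\<And>m. m < p ^ exponent \<Longrightarrow> taylor u (w m) = hmonom 1 m"
    by metis
  \<comment> \<open>The inverse map. That \<open>r (taylor u f)\<close> is f follows from agreement
    of their Taylor series below \<open>p ^ exponent\<close>; this in turn shows that
    \<open>taylor u f\<close> has no higher terms.\<close>
  define r where "r F = (\<Sum>m<p ^ exponent. hconst (hnth F m) * w m)" for F
  have r_mem: "r F \<in> A" for F
    unfolding r_def using w(1) by (intro sum_mem hconst_mult_mem) auto
  have r_nth: "hnth (taylor u (r F)) i = (if i < p ^ exponent then hnth F i else 0)" for F i
  proof -
    have "hnth (sum h S) i = (\<Sum>m\<in>S. hnth (h m) i)" for h :: "nat \<Rightarrow> 'k hurwitz" and S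
      by (induction S rule: infinite_finite_induct) auto
    then have "hnth (taylor u (r F)) i = (\<Sum>m<p ^ exponent. hnth F m * (if i = m then 1 else 0))"
      by (simp add: r_def taylor_sum taylor_mult w hnth_hmonom)
    also have "\<dots> = (\<Sum>m<p ^ exponent. if i = m then hnth F m else 0)"
      by (intro sum.cong) auto
    finally show ?thesis by simp
  qed
  have inj: "f = 0" if "f \<in> A" "\<forall>i<p ^ exponent. hnth (taylor u f) i = 0" for f
    using low[OF that(2)] that(1) by (intro eq_0_if_low_eq_0) (auto simp: height_eq)
  have r_taylor: "r (taylor u f) = f" if "f \<in> A" for f
  proof -
    have "f - r (taylor u f) = 0"
      by (intro inj diff_mem that r_mem) (simp add: taylor_diff r_nth)
    then show ?thesis by simp
  qed
  have "bij_betw (taylor u) A {f. \<forall>i\<ge>p ^ exponent. hnth f i = 0}"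
  proof (rule bij_betw_byWitness[where f' = r])
    show "\<forall>f\<in>A. r (taylor u f) = f" using r_taylor by blast
    show "\<forall>F\<in>{f. \<forall>i\<ge>p ^ exponent. hnth f i = 0}. taylor u (r F) = F"
      by (auto intro!: hurwitz_eqI simp: r_nth)
    show "taylor u ` A \<subseteq> {f. \<forall>i\<ge>p ^ exponent. hnth f i = 0}"
    proof clarify
      fix f i assume "f \<in> A" "p ^ exponent \<le> i"
      then show "hnth (taylor u f) i = 0"
        using r_nth[of "taylor u f" i] r_taylor by simp
    qed
  qed (use r_mem in auto)
  then show ?thesis using u by blast
qed

end

section \<open>Common eigenvectors\<close>

locale alg_closed_vector_space = finite_dimensional_vector_space scale Basis
  for scale :: "'k::alg_closed_field \<Rightarrow> 'v::ab_group_add \<Rightarrow> 'v" and Basis :: "'v set"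
begin

lemma linear_simps:
  assumes "Vector_Spaces.linear scale scale T"
  shows "T (x + y) = T x + T y" "T (x - y) = T x - T y" "T (- x) = - T x"
    "T (scale c x) = scale c (T x)" "T 0 = 0"
  using assms by (simp_all add: module_hom.add module_hom.diff module_hom.neg module_hom.scale
    module_hom.zero flip: module_hom_iff_linear)

lemma in_span_image_lessThan:
  fixes f :: "nat \<Rightarrow> 'v"
  shows "x \<in> span (f ` {..<n}) \<Longrightarrow> \<exists>c. x = (\<Sum>i<n. scale (c i) (f i))"
proof (induction n arbitrary: x)
  case (Suc n)
  obtain k where "x - scale k (f n) \<in> span (f ` {..<n})"
    using Suc.prems by (auto simp: lessThan_Suc span_breakdown_eq)
  from Suc.IH[OF this] obtain c where "x - scale k (f n) = (\<Sum>i<n. scale (c i) (f i))"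
    by blast
  then have "x = (\<Sum>i<Suc n. scale ((c(n := k)) i) (f i))"
    by (simp add: diff_eq_eq)
  then show ?case by blast
qed simp

lemma ex_in_span_previous:
  fixes f :: "nat \<Rightarrow> 'v"
  shows "\<exists>n. f n \<in> span (f ` {..<n})"
proof (rule ccontr)
  assume *: "\<not> ?thesis"
  have "independent (f ` {..<n}) \<and> card (f ` {..<n}) = n" for n :: nat
  proof (induction n)
    case (Suc n)
    have "f n \<notin> span (f ` {..<n})" using * by simp
    moreover from this have "f n \<notin> f ` {..<n}" by (meson span_base)
    ultimately show ?case using Suc by (simp add: lessThan_Suc independent_insertI)
  qed (simp add: independent_empty)
  from this[of "Suc (dim UNIV)"] show False
    using independent_card_le_dim[of "f ` {..<Suc (dim UNIV)}" UNIV] by simp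
qed

definition poly_apply :: "('v \<Rightarrow> 'v) \<Rightarrow> 'k poly \<Rightarrow> 'v \<Rightarrow> 'v" where
  "poly_apply T q v = (\<Sum>i\<le>degree q. scale (coeff q i) ((T ^^ i) v))"

text \<open>Some nonzero polynomial in T kills v. After splitting off a root, the remaining factor
  applied to v is an eigenvector, or it kills v and has smaller degree.\<close>

lemma eigenvector_in_invariant_subspace:
  assumes T: "Vector_Spaces.linear scale scale T"
    and U: "subspace U" "\<And>x. x \<in> U \<Longrightarrow> T x \<in> U" and v: "v \<in> U" "v \<noteq> 0"
  shows "\<exists>w\<in>U. \<exists>c. w \<noteq> 0 \<and> T w = scale c w"
proof -
  note T = linear_simps[OF T]
  have poly_apply_0: "poly_apply T 0 v = 0" by (simp add: poly_apply_def)
  have poly_apply_pCons: "poly_apply T (pCons a q) v = scale a v + T (poly_apply T q v)" for a q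
  proof (cases "q = 0")
    case True
    then show ?thesis by (simp add: poly_apply_def T)
  next
    case False
    have sum: "T (sum f S) = (\<Sum>i\<in>S. T (f i))" for f and S :: "nat set"
      by (induction S rule: infinite_finite_induct) (simp_all add: T)
    show ?thesis using False
      by (simp add: poly_apply_def sum.atMost_Suc_shift sum T del: sum.atMost_Suc)
  qed
  have poly_apply_add: "poly_apply T (q + r) v = poly_apply T q v + poly_apply T r v" for q r
    by (induction q r rule: poly_induct2)
      (simp_all add: poly_apply_0 poly_apply_pCons T scale_left_distrib)
  have poly_apply_smult: "poly_apply T (smult c q) v = scale c (poly_apply T q v)" for c q
    by (induction q) (simp_all add: poly_apply_0 poly_apply_pCons T scale_right_distrib)
  have poly_apply_monom: "poly_apply T (monom c i) v = scale c ((T ^^ i) v)" for c i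
    by (induction i) (simp_all add: monom_0 monom_Suc poly_apply_0 poly_apply_pCons T)
  have poly_apply_sum: "poly_apply T (sum f S) v = (\<Sum>i\<in>S. poly_apply T (f i) v)"
    for f and S :: "nat set"
    by (induction S rule: infinite_finite_induct) (simp_all add: poly_apply_0 poly_apply_add)
  have mem: "poly_apply T q v \<in> U" for q
    using v by (induction q) (auto simp: poly_apply_0 poly_apply_pCons
        intro!: subspace_0 subspace_add subspace_scale U)
  obtain q where "q \<noteq> 0" "poly_apply T q v = 0"
  proof -
    obtain n where "(T ^^ n) v \<in> span ((\<lambda>i. (T ^^ i) v) ` {..<n})"
      using ex_in_span_previous[of "\<lambda>i. (T ^^ i) v"] by blast
    then obtain c where c: "(T ^^ n) v = (\<Sum>i<n. scale (c i) ((T ^^ i) v))"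
      using in_span_image_lessThan by blast
    define q where "q = monom 1 n + (\<Sum>i<n. monom (- c i) i)"
    have "coeff q n = 1" by (simp add: q_def coeff_sum)
    then have "q \<noteq> 0" by auto
    moreover have "poly_apply T q v = 0"
      by (simp add: q_def poly_apply_add poly_apply_sum poly_apply_monom c scale_minus_left sum_negf)
    ultimately show ?thesis by (rule that)
  qed
  then show ?thesis
  proof (induction "degree q" arbitrary: q)
    case 0
    then obtain a where "q = [:a:]" "a \<noteq> 0" by (metis degree_eq_zeroE pCons_0_0)
    then show ?case using 0 v by (simp add: poly_apply_pCons poly_apply_0 T)
  next
    case (Suc n)
    obtain c where "poly q c = 0" using alg_closed_imp_poly_has_root[of q] Suc.hyps by auto
    then obtain r where r: "q = [:- c, 1:] * r" by (auto simp: poly_eq_0_iff_dvd)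
    have "r \<noteq> 0" using r Suc.prems by auto
    then have "degree r = n" using Suc.hyps(2) degree_mult_eq[of "[:- c, 1:]" r] by (simp add: r del: mult_pCons_left)
    have q: "q = smult (- c) r + pCons 0 r" by (simp add: r)
    have "poly_apply T q v = T (poly_apply T r v) - scale c (poly_apply T r v)"
      unfolding q poly_apply_add poly_apply_smult poly_apply_pCons by simp
    then show ?case
      using Suc.hyps(1)[of r] \<open>degree r = n\<close> \<open>r \<noteq> 0\<close> mem[of r] Suc.prems by (cases "poly_apply T r v = 0") auto
  qed
qed

text \<open>In a nonzero invariant subspace of least dimension, an eigenspace of a member of F is
  again invariant by commutativity, hence is the whole subspace. F may be infinite.\<close>

lemma common_eigenvector:
  assumes nontrivial: "(v :: 'v) \<noteq> 0"
    and linear: "\<And>T. T \<in> F \<Longrightarrow> Vector_Spaces.linear scale scale T"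
    and commute: "\<And>S T x. S \<in> F \<Longrightarrow> T \<in> F \<Longrightarrow> S (T x) = T (S x)"
  shows "\<exists>s c. s \<noteq> 0 \<and> (\<forall>T\<in>F. T s = scale (c T) s)"
proof -
  define invariant where "invariant U \<longleftrightarrow> subspace U \<and> (\<exists>u\<in>U. u \<noteq> 0) \<and> (\<forall>T\<in>F. \<forall>u\<in>U. T u \<in> U)" for U
  have "invariant UNIV" using nontrivial by (auto simp: invariant_def)
  then have "\<exists>U. invariant U \<and> (\<forall>W. invariant W \<longrightarrow> dim U \<le> dim W)" by (rule ex_has_least_nat[of invariant UNIV dim])
  then obtain U where U: "invariant U" "\<And>W. invariant W \<Longrightarrow> dim U \<le> dim W"
    by auto
  obtain u where u: "u \<in> U" "u \<noteq> 0" using U(1) by (auto simp: invariant_def)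
  have "\<exists>c. T u = scale c u" if T: "T \<in> F" for T
  proof -
    obtain w c where w: "w \<in> U" "w \<noteq> 0" "T w = scale c w"
      using eigenvector_in_invariant_subspace[OF linear[OF T], of U u] U(1) T u
      by (auto simp: invariant_def)
    define W where "W = {x \<in> U. T x = scale c x}"
    have "subspace W"
      using U(1) unfolding W_def invariant_def subspace_def
      by (auto simp: linear_simps[OF linear[OF T]] scale_right_distrib mult.commute)
    moreover have "S x \<in> W" if "S \<in> F" "x \<in> W" for S x
      using that U(1) commute[OF that(1) T, of x] linear_simps(4)[OF linear[OF that(1)]]
      by (auto simp: W_def invariant_def)
    ultimately have "invariant W" using w unfolding invariant_def W_def by blast
    have "W = U"
    proof (rule subspace_dim_equal)
      show "dim U \<le> dim W" by (rule U(2)) fact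
      show "subspace U" using U(1) by (simp add: invariant_def)
      show "subspace W" by fact
    qed (auto simp: W_def)
    then show ?thesis using u by (auto simp: W_def)
  qed
  then obtain c where "\<forall>T\<in>F. T u = scale (c T) u" by metis
  then show ?thesis using u by blast
qed

end

section \<open>From transposed Poisson algebras to differential algebras\<close>

locale simple_tpa = transposed_poisson_algebra scale circ bracket +
    alg_closed_vector_space scale Basis
  for scale :: "'k::alg_closed_field \<Rightarrow> 'v::ab_group_add \<Rightarrow> 'v"
    and circ :: "'v \<Rightarrow> 'v \<Rightarrow> 'v" (infixl \<open>\<odot>\<close> 70) and bracket Basis +
  assumes char_gt_3: "CHAR('k) > 3"
    and simple: "is_simple"
    and nontrivial: "\<not> is_trivial"
begin

lemmas circ_right_simps = linear_simps[OF mult_linear_right]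
lemmas bracket_left_simps = linear_simps[OF bracket_linear_left]
lemmas bracket_right_simps = linear_simps[OF bracket_linear_right]
lemmas bracket_simps = bracket_left_simps bracket_right_simps

lemma of_nat_neq_0_le_3: "0 < n \<Longrightarrow> n \<le> 3 \<Longrightarrow> of_nat n \<noteq> (0 :: 'k)"
  using char_gt_3 by (auto simp: of_nat_eq_0_iff_char_dvd dest: dvd_imp_le)

lemma double_eq_0: "x + x = 0 \<longleftrightarrow> x = (0 :: 'v)"
proof -
  have "x + x = scale (of_nat 2) x" by (simp add: scale_left_distrib[of 1 1, simplified])
  then show ?thesis using of_nat_neq_0_le_3[of 2] by simp
qed

lemma double_cancel: "x + x = y + y \<longleftrightarrow> x = (y :: 'v)"
  using double_eq_0[of "x - y"] by (simp add: algebra_simps)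

lemma triple_eq_0: "x + x + x = 0 \<longleftrightarrow> x = (0 :: 'v)"
proof -
  have "x + x + x = scale (1 + 1 + 1) x" by (simp only: scale_left_distrib scale_one)
  then show ?thesis using of_nat_neq_0_le_3[of 3] by simp
qed

lemma bracket_anticomm: "bracket y x = - bracket x y"
proof -
  have "bracket (x + y) (x + y) = bracket x y + bracket y x"
    unfolding bracket_simps by (simp add: bracket_alternating)
  then show ?thesis by (simp add: bracket_alternating eq_neg_iff_add_eq_0 add.commute)
qed

lemma bracket_jacobi:
  "bracket x (bracket y z) = bracket (bracket x y) z + bracket y (bracket x z)"
proof -
  have "bracket x (bracket y z) + (bracket y (bracket z x) + bracket z (bracket x y)) = 0"
    using jacobi[of x y z] by (simp only: add.assoc)
  then have "bracket x (bracket y z) = - (bracket y (bracket z x) + bracket z (bracket x y))"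
    by (simp only: eq_neg_iff_add_eq_0)
  then show ?thesis
    using bracket_anticomm[of "bracket x y" z] bracket_anticomm[of x z] by (simp add: bracket_simps)
qed

lemma ideal_trivial: "is_ideal I \<Longrightarrow> I = {0} \<or> I = UNIV"
  using simple by (auto simp: is_simple_def)

lemma is_idealI:
  assumes "subspace I" "\<And>a x. x \<in> I \<Longrightarrow> a \<odot> x \<in> I" "\<And>a x. x \<in> I \<Longrightarrow> bracket a x \<in> I"
  shows "is_ideal I"
  using assms by (simp add: is_ideal_def)

section \<open>Half-derivations and their commutators with adjoint operators\<close>

definition half_derivation :: "('v \<Rightarrow> 'v) \<Rightarrow> bool" where
  "half_derivation f \<longleftrightarrow> Vector_Spaces.linear scale scale f \<and>
     (\<forall>y z. f (bracket y z) + f (bracket y z) = bracket (f y) z + bracket y (f z))"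

definition ad_comm :: "('v \<Rightarrow> 'v) \<Rightarrow> 'v \<Rightarrow> 'v \<Rightarrow> 'v" where
  "ad_comm f y z = f (bracket y z) - bracket y (f z)"

lemma half_derivation_linear:
  assumes "half_derivation f"
  shows "f (x + y) = f x + f y" "f (x - y) = f x - f y" "f (- x) = - f x"
    "f (scale c x) = scale c (f x)" "f 0 = 0"
  using assms linear_simps unfolding half_derivation_def by blast+

lemma half_derivation_bracket_left:
  assumes "half_derivation f"
  shows "bracket (f y) z = f (bracket y z) + f (bracket y z) - bracket y (f z)"
  using assms unfolding half_derivation_def by (simp add: algebra_simps)

lemma half_derivation_circ: "half_derivation ((\<odot>) x)"
proof -
  have "x \<odot> bracket y z + x \<odot> bracket y z = bracket (x \<odot> y) z + bracket y (x \<odot> z)" for y z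
    using transposed_leibniz[of x y z] scale_left_distrib[of 1 1 "x \<odot> bracket y z"] by simp
  then show ?thesis by (simp add: half_derivation_def mult_linear_right)
qed

text \<open>Skew-symmetry of the bracket and the half-derivation rule; \<open>ad_comm f\<close> thus
  becomes a commutative product.\<close>

lemma ad_comm_commute:
  assumes "half_derivation f"
  shows "ad_comm f y z = ad_comm f z y"
proof -
  have "ad_comm f z y = f (- bracket y z) + bracket (f y) z"
    using bracket_anticomm[of z y] bracket_anticomm[of z "f y"] by (simp add: ad_comm_def)
  then show ?thesis
    by (simp add: half_derivation_bracket_left[OF assms] half_derivation_linear[OF assms] ad_comm_def)
qed

lemma ad_comm_linear:
  assumes "half_derivation f"
  shows "Vector_Spaces.linear scale scale (ad_comm f y)"
  unfolding module_hom_iff_linear[symmetric] module_hom_iff ad_comm_def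
  by (simp add: module_axioms half_derivation_linear[OF assms] bracket_simps scale_right_diff_distrib)

text \<open>The commutator of a half-derivation with a derivation is a half-derivation; the three
  Jacobi instances express that \<open>bracket y\<close> is a derivation.\<close>

lemma half_derivation_ad_comm:
  assumes f: "half_derivation f"
  shows "half_derivation (ad_comm f y)"
  unfolding half_derivation_def
proof (intro conjI allI ad_comm_linear[OF f])
  fix z w
  note hd = half_derivation_bracket_left[OF f]
  have "bracket (ad_comm f y z) w = bracket (f (bracket y z)) w - bracket (bracket y (f z)) w"
    by (simp add: ad_comm_def bracket_simps)
  also have "\<dots> = f (bracket (bracket y z) w) + f (bracket (bracket y z) w)
      - bracket (bracket y z) (f w) - bracket (bracket y (f z)) w"
    by (simp add: hd)
  finally have 1: "bracket (ad_comm f y z) w = \<dots>" .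
  have "bracket z (ad_comm f y w) = bracket z (f (bracket y w)) - bracket z (bracket y (f w))"
    by (simp add: ad_comm_def bracket_simps)
  also have "bracket z (f (bracket y w)) =
      f (bracket z (bracket y w)) + f (bracket z (bracket y w)) - bracket (f z) (bracket y w)"
    by (simp add: hd)
  finally have 2: "bracket z (ad_comm f y w) = \<dots> - bracket z (bracket y (f w))" .
  have "ad_comm f y (bracket z w) + ad_comm f y (bracket z w) =
      f (bracket y (bracket z w)) + f (bracket y (bracket z w))
      - bracket y (f (bracket z w) + f (bracket z w))"
    by (simp add: ad_comm_def bracket_simps algebra_simps)
  also have "f (bracket z w) + f (bracket z w) = bracket (f z) w + bracket z (f w)"
    by (simp add: hd)
  finally show "ad_comm f y (bracket z w) + ad_comm f y (bracket z w) =
      bracket (ad_comm f y z) w + bracket z (ad_comm f y w)"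
    unfolding 1 2 bracket_simps
    using bracket_jacobi[of y z w] bracket_jacobi[of y "f z" w] bracket_jacobi[of y z "f w"]
    by (simp add: half_derivation_linear[OF f] algebra_simps)
qed

section \<open>Commutative semigroups of half-derivations\<close>

definition compatible :: "('v \<Rightarrow> 'v) set \<Rightarrow> bool" where
  "compatible C \<longleftrightarrow> (\<forall>f\<in>C. half_derivation f) \<and> (\<forall>f\<in>C. \<forall>g\<in>C. f \<circ> g \<in> C) \<and>
     (\<forall>f\<in>C. \<forall>g\<in>C. \<forall>z. f (g z) = g (f z))"

context
  fixes C
  assumes C: "compatible C"
begin

lemma compatible_half_derivation: "f \<in> C \<Longrightarrow> half_derivation f"
  and compatible_comp: "f \<in> C \<Longrightarrow> g \<in> C \<Longrightarrow> f \<circ> g \<in> C"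
  and compatible_commute: "f \<in> C \<Longrightarrow> g \<in> C \<Longrightarrow> f (g z) = g (f z)"
  using C by (auto simp: compatible_def)

text \<open>Compute \<open>bracket (f (g y)) z\<close> twice, by the rule for
  \<open>f \<circ> g\<close> and by the rules for f and g in succession. The difference is twice the
  claim.\<close>

lemma commute_ad_comm:
  assumes f: "f \<in> C" and g: "g \<in> C"
  shows "f (ad_comm g y z) = ad_comm g y (f z)"
proof -
  note hf = compatible_half_derivation[OF f] and hg = compatible_half_derivation[OF g]
  note lin = half_derivation_linear[OF hf] half_derivation_linear[OF hg]
  note hdf = half_derivation_bracket_left[OF hf] and hdg = half_derivation_bracket_left[OF hg]
  have "bracket (f (g y)) z = f (g (bracket y z)) + f (g (bracket y z)) - bracket y (f (g z))"
    using half_derivation_bracket_left[OF compatible_half_derivation[OF compatible_comp[OF f g]]]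
    by simp
  moreover have "bracket (f (g y)) z =
      f (g (bracket y z) + g (bracket y z) - bracket y (g z)) +
      f (g (bracket y z) + g (bracket y z) - bracket y (g z)) -
      (g (bracket y (f z)) + g (bracket y (f z)) - bracket y (g (f z)))"
    unfolding hdf hdg ..
  ultimately have "f (ad_comm g y z) + f (ad_comm g y z) = ad_comm g y (f z) + ad_comm g y (f z)"
    using compatible_commute[OF f g, of z]
    by (simp add: ad_comm_def lin bracket_simps algebra_simps)
  then show ?thesis by (simp add: double_cancel)
qed

lemma ad_comm_apply:
  assumes f: "f \<in> C" and g: "g \<in> C"
  shows "ad_comm g (f u) z = f (ad_comm g u z)"
  using commute_ad_comm[OF f g, of z u]
  by (simp add: ad_comm_commute[OF compatible_half_derivation[OF g]])

lemma ad_comm_ad_comm: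
  assumes f: "f \<in> C" and g: "g \<in> C"
  shows "ad_comm g (ad_comm f y z) w =
    ad_comm f y (ad_comm g z w) + ad_comm f y (ad_comm g z w) - ad_comm g z (ad_comm f y w)"
proof -
  note hf = compatible_half_derivation[OF f] and hg = compatible_half_derivation[OF g]
  note hfy = half_derivation_ad_comm[OF hf, of y]
  have "ad_comm g (ad_comm f y z) w = g (bracket (ad_comm f y z) w) - bracket (ad_comm f y z) (g w)"
    by (simp add: ad_comm_def)
  also have "\<dots> = g (ad_comm f y (bracket z w)) + g (ad_comm f y (bracket z w))
      - g (bracket z (ad_comm f y w))
      - (ad_comm f y (bracket z (g w)) + ad_comm f y (bracket z (g w)) - bracket z (ad_comm f y (g w)))"
    by (simp add: half_derivation_bracket_left[OF hfy] half_derivation_linear[OF hg])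
  also have "\<dots> = ad_comm f y (g (bracket z w) - bracket z (g w)) + ad_comm f y (g (bracket z w) - bracket z (g w))
      - (g (bracket z (ad_comm f y w)) - bracket z (g (ad_comm f y w)))"
    by (simp add: commute_ad_comm[OF g f] half_derivation_linear[OF hfy] algebra_simps)
  finally show ?thesis by (simp add: ad_comm_def)
qed

text \<open>
  With \<open>t\<^sub>y = ad_comm f y (ad_comm g z w)\<close> and \<open>t'\<^sub>y = ad_comm g y (ad_comm f z w)\<close>, each
  symmetric in \<open>z, w\<close>, the previous lemma says \<open>t'\<^sub>w + t'\<^sub>z = 2 t\<^sub>y\<close> and, with \<open>f, g\<close> exchanged,
  \<open>t\<^sub>w + t\<^sub>z = 2 t'\<^sub>y\<close>, for all permutations of \<open>y, z, w\<close>; in characteristic other than \<open>2, 3\<close> this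
  makes all six expressions equal.
\<close>

lemma ad_comm_total_symmetry:
  assumes f: "f \<in> C" and g: "g \<in> C"
  shows "ad_comm f y (ad_comm g z w) = ad_comm g z (ad_comm f y w)"
    and "ad_comm f y (ad_comm g z w) = ad_comm g (ad_comm f y z) w"
proof -
  note cf = ad_comm_commute[OF compatible_half_derivation[OF f]]
    and cg = ad_comm_commute[OF compatible_half_derivation[OF g]]
  define ty where "ty = ad_comm f y (ad_comm g z w)"
  define tz where "tz = ad_comm f z (ad_comm g w y)"
  define tw where "tw = ad_comm f w (ad_comm g y z)"
  define sy where "sy = ad_comm g y (ad_comm f z w)"
  define sz where "sz = ad_comm g z (ad_comm f w y)"
  define sw where "sw = ad_comm g w (ad_comm f y z)"
  have sum: "ad_comm g w (ad_comm f y z) + ad_comm g z (ad_comm f w y) =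
      ad_comm f y (ad_comm g z w) + ad_comm f y (ad_comm g z w)"
    if f: "f \<in> C" and g: "g \<in> C" for f g y z w
    using ad_comm_ad_comm[OF f g, of y z w]
      ad_comm_commute[OF compatible_half_derivation[OF g], of w "ad_comm f y z"]
      ad_comm_commute[OF compatible_half_derivation[OF f], of w y]
    by simp
  have s: "sw + sz = ty + ty" "sy + sw = tz + tz" "sz + sy = tw + tw"
    using sum[OF f g] unfolding ty_def tz_def tw_def sy_def sz_def sw_def by blast+
  have t: "tw + tz = sy + sy" "ty + tw = sz + sz" "tz + ty = sw + sw"
    using sum[OF g f] unfolding ty_def tz_def tw_def sy_def sz_def sw_def by blast+
  \<comment> \<open>The hypotheses give \<open>a - b = 2 (x - y)\<close> and
    \<open>x - y = 2 (a - b)\<close>, hence \<open>3 (a - b) = 0\<close>.\<close>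
  have eq: "a = b" if "a + c = x + x" "b + c = y + y" "x + z = a + a" "y + z = b + b"
    for a b c x y z :: 'v
  proof -
    define d where "d = a - b"
    have "d = (x + x) - (y + y)" unfolding that(1,2)[symmetric] d_def by simp
    also have "\<dots> = (x - y) + (x - y)" by simp
    also have "x - y = (a + a) - (b + b)" unfolding that(3,4)[symmetric] by simp
    also have "\<dots> = d + d" by (simp add: d_def)
    finally have "d + d + d = 0" by (simp add: add.assoc)
    then show ?thesis unfolding triple_eq_0 by (simp add: d_def)
  qed
  have "sz = sy" by (rule eq[of sz sw ty sy tz tw]) (use s t in \<open>simp_all add: add.commute\<close>)
  moreover have "sw = sy" by (rule eq[of sw sz ty sy tw tz]) (use s t in \<open>simp_all add: add.commute\<close>)
  ultimately have all: "sz = sy" "sw = sy" "ty = sy"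
    using s(1) by (simp_all add: double_cancel)
  then show "ad_comm f y (ad_comm g z w) = ad_comm g z (ad_comm f y w)"
    unfolding ty_def sz_def by (simp add: cf[of w y])
  show "ad_comm f y (ad_comm g z w) = ad_comm g (ad_comm f y z) w"
    using all unfolding ty_def sw_def by (simp add: cg[of w])
qed

end

definition extend :: "('v \<Rightarrow> 'v) set \<Rightarrow> ('v \<Rightarrow> 'v) set" where
  "extend C = C \<union> {ad_comm f y |f y. f \<in> C}"

text \<open>In a composite an old operator is absorbed into the subscript of a new one, and two new
  operators merge into one by total symmetry.\<close>

lemma compatible_extend:
  assumes C: "compatible C"
  shows "compatible (extend C)"
proof -
  note hd = compatible_half_derivation[OF C]
  have "half_derivation f" if "f \<in> extend C" for f
    using that by (auto simp: extend_def hd half_derivation_ad_comm)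
  moreover have "f \<circ> g \<in> extend C" if "f \<in> extend C" "g \<in> extend C" for f g
  proof -
    have fg: "f \<circ> ad_comm g y = ad_comm g (f y)" "ad_comm g y \<circ> f = ad_comm g (f y)"
      if "f \<in> C" "g \<in> C" for f g y
      using that by (auto simp: fun_eq_iff ad_comm_apply[OF C] commute_ad_comm[OF C])
    have "ad_comm f y \<circ> ad_comm g z = ad_comm g (ad_comm f y z)" if "f \<in> C" "g \<in> C" for f g y z
      using ad_comm_total_symmetry(2)[OF C that] by (auto simp: fun_eq_iff)
    moreover have "f \<in> extend C" "ad_comm f y \<in> extend C" if "f \<in> C" for f y
      using that by (auto simp: extend_def)
    moreover have "f \<in> C \<or> (\<exists>f' y. f' \<in> C \<and> f = ad_comm f' y)" if "f \<in> extend C" for f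
      using that by (auto simp: extend_def)
    ultimately show ?thesis
      using that fg compatible_comp[OF C] by metis
  qed
  moreover have "f (g z) = g (f z)" if "f \<in> extend C" "g \<in> extend C" for f g z
    using that compatible_commute[OF C] commute_ad_comm[OF C] ad_comm_total_symmetry(1)[OF C]
    unfolding extend_def by auto
  ultimately show ?thesis by (simp add: compatible_def)
qed

text \<open>The closure of the multiplication operators under \<open>ad_comm\<close>. The stages
  increase, so any two members lie in a common one.\<close>

definition ops :: "('v \<Rightarrow> 'v) set" where
  "ops = (\<Union>i. (extend ^^ i) (range (\<odot>)))"

lemma circ_mem_ops: "(\<odot>) x \<in> ops"
  unfolding ops_def by (rule UN_I[of 0]) auto

lemma ad_comm_mem_ops:
  assumes "f \<in> ops"
  shows "ad_comm f y \<in> ops"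
proof -
  obtain i where "f \<in> (extend ^^ i) (range (\<odot>))" using assms by (auto simp: ops_def)
  then have "ad_comm f y \<in> (extend ^^ Suc i) (range (\<odot>))"
    by (auto simp: extend_def)
  then show ?thesis unfolding ops_def by blast
qed

lemma compatible_ops: "compatible ops"
proof -
  have *: "compatible ((extend ^^ i) (range (\<odot>)))" for i
  proof (induction i)
    case 0
    have "(\<odot>) x \<circ> (\<odot>) y = (\<odot>) (x \<odot> y)" for x y by (simp add: fun_eq_iff mult_assoc)
    moreover have "x \<odot> (y \<odot> z) = y \<odot> (x \<odot> z)" for x y z by (metis mult_assoc mult_commute)
    ultimately show ?case by (auto simp: compatible_def half_derivation_circ)
  qed (simp add: compatible_extend)
  have mono: "(extend ^^ i) (range (\<odot>)) \<subseteq> (extend ^^ j) (range (\<odot>))" if "i \<le> j" for i j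
    using that by (rule lift_Suc_mono_le[rotated]) (auto simp: extend_def)
  have "\<exists>i. f \<in> (extend ^^ i) (range (\<odot>)) \<and> g \<in> (extend ^^ i) (range (\<odot>))"
    if fg: "f \<in> ops" "g \<in> ops" for f g
  proof -
    obtain i j where "f \<in> (extend ^^ i) (range (\<odot>))" "g \<in> (extend ^^ j) (range (\<odot>))"
      using fg by (auto simp: ops_def)
    then show ?thesis using mono[of i "max i j"] mono[of j "max i j"] by auto
  qed
  note stage = this
  show ?thesis
    unfolding compatible_def
  proof (intro conjI ballI allI)
    fix f assume "f \<in> ops"
    with stage[of f f] * show "half_derivation f" by (auto simp: compatible_def)
  next
    fix f g assume "f \<in> ops" "g \<in> ops"
    then obtain i where i: "f \<in> (extend ^^ i) (range (\<odot>))" "g \<in> (extend ^^ i) (range (\<odot>))"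
      using stage by blast
    then have "f \<circ> g \<in> (extend ^^ i) (range (\<odot>))" using compatible_comp[OF *] by simp
    then show "f \<circ> g \<in> ops" by (auto simp: ops_def)
    show "f (g z) = g (f z)" for z using i by (rule compatible_commute[OF *])
  qed
qed

lemmas ops_half_derivation = compatible_half_derivation[OF compatible_ops]
lemmas ops_linear_simps = half_derivation_linear[OF ops_half_derivation]
lemmas ops_commute = compatible_commute[OF compatible_ops]

lemma ops_linear: "f \<in> ops \<Longrightarrow> Vector_Spaces.linear scale scale f"
  using ops_half_derivation by (simp add: half_derivation_def)

lemma ops_bracket: "f (bracket y z) = bracket y (f z) + ad_comm f y z"
  by (simp add: ad_comm_def)

section \<open>Consequences of simplicity\<close>

lemma ex_ad_comm_neq_0: "\<exists>f\<in>ops. \<exists>y z. ad_comm f y z \<noteq> 0"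
proof (rule ccontr)
  assume "\<not> ?thesis"
  then have 0: "x \<odot> bracket y z = bracket y (x \<odot> z)" for x y z
    using circ_mem_ops by (auto simp: ad_comm_def)
  \<comment> \<open>An expression symmetric in x, y and skew in y, z is zero when 2 is
    invertible.\<close>
  have "x \<odot> bracket y z = y \<odot> bracket x z" for x y z
  proof -
    have "x \<odot> bracket z y = y \<odot> bracket z x"
      unfolding 0 by (simp only: mult_commute)
    then show ?thesis
      by (simp only: bracket_anticomm[of z y] bracket_anticomm[of z x] circ_right_simps neg_equal_iff_equal)
  qed
  then have "x \<odot> bracket y z = - (x \<odot> bracket y z)" for x y z
    by (metis bracket_anticomm circ_right_simps(3))
  then have circ_bracket: "x \<odot> bracket y z = 0" for x y z
    by (metis double_eq_0 eq_neg_iff_add_eq_0)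
  \<comment> \<open>The derived algebra is annihilated by the multiplication, hence an ideal. Being
    nonzero it is everything, and the multiplication is zero.\<close>
  define I where "I = span {bracket y z |y z. True}"
  have "is_ideal I"
  proof (rule is_idealI)
    show "a \<odot> x \<in> I" if "x \<in> I" for a x
    proof -
      have "a \<odot> x = 0"
        using that unfolding I_def
        by (induction rule: span_induct_alt) (auto simp: circ_right_simps circ_bracket)
      then show ?thesis by (simp add: I_def span_zero)
    qed
    show "bracket a x \<in> I" if "x \<in> I" for a x
      unfolding I_def by (rule span_base) blast
  qed (simp add: I_def)
  moreover have "I \<noteq> {0}"
  proof -
    obtain y z where "bracket y z \<noteq> 0" using nontrivial by (auto simp: is_trivial_def)
    moreover have "bracket y z \<in> I" unfolding I_def by (rule span_base) blast
    ultimately show ?thesis by auto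
  qed
  ultimately have "I = UNIV" using ideal_trivial by blast
  have "a \<odot> x = 0" for a x
  proof -
    have "x \<in> I" using \<open>I = UNIV\<close> by simp
    then show ?thesis unfolding I_def
      by (induction rule: span_induct_alt) (auto simp: circ_right_simps circ_bracket)
  qed
  then show False using nontrivial by (auto simp: is_trivial_def)
qed

text \<open>A common eigenvector of \<open>ops\<close> has eigenvalues \<open>c\<close>, and
  simplicity makes \<open>c\<close> nonzero at some \<open>g = ad_comm f y\<close>. The generalised
  kernel of g is an ideal without that eigenvector, hence zero.\<close>

lemma ex_bijective_ad_comm: "\<exists>f\<in>ops. \<exists>y. inj (ad_comm f y) \<and> surj (ad_comm f y)"
proof -
  obtain v :: 'v where "v \<noteq> 0" using simple by (auto simp: is_simple_def)
  then obtain s c where s: "s \<noteq> 0" "\<forall>T\<in>ops. T s = scale (c T) s"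
    using common_eigenvector[of v ops] ops_linear ops_commute by blast
  have "\<exists>f\<in>ops. \<exists>y. c (ad_comm f y) \<noteq> 0"
  proof (rule ccontr)
    assume "\<not> ?thesis"
    then have c0: "c (ad_comm f y) = 0" if "f \<in> ops" for f y using that by blast
    \<comment> \<open>If \<open>c\<close> vanishes on all commutators, the joint eigenspace is
      stable under brackets, hence everything, and every \<open>ad_comm f y\<close> is zero.\<close>
    define K where "K = {z. \<forall>f\<in>ops. f z = scale (c f) z}"
    have "is_ideal K"
    proof (rule is_idealI)
      show "subspace K"
        unfolding subspace_def K_def
        by (auto simp: ops_linear_simps scale_right_distrib mult.commute)
      show "a \<odot> x \<in> K" if "x \<in> K" for a x
        unfolding K_def
      proof safe
        fix f assume f: "f \<in> ops"
        have "f (a \<odot> x) = a \<odot> f x" by (rule ops_commute[OF f circ_mem_ops])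
        moreover have "f x = scale (c f) x" using that f unfolding K_def by blast
        ultimately show "f (a \<odot> x) = scale (c f) (a \<odot> x)"
          by (simp add: circ_right_simps)
      qed
      show "bracket a x \<in> K" if "x \<in> K" for a x
        unfolding K_def
      proof safe
        fix f assume f: "f \<in> ops"
        have "ad_comm f a x = scale (c (ad_comm f a)) x"
          using that ad_comm_mem_ops[OF f, of a] unfolding K_def by blast
        moreover have "f x = scale (c f) x" using that f unfolding K_def by blast
        ultimately show "f (bracket a x) = scale (c f) (bracket a x)"
          using ops_bracket[of f a x] c0[OF f] by (simp add: bracket_simps)
      qed
    qed
    moreover have "s \<in> K" using s by (simp add: K_def)
    ultimately have "K = UNIV" using ideal_trivial s(1) by blast
    then have "ad_comm f y z = 0" if "f \<in> ops" for f y z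
    proof -
      have "z \<in> K" using \<open>K = UNIV\<close> by simp
      then have "ad_comm f y z = scale (c (ad_comm f y)) z"
        using ad_comm_mem_ops[OF that, of y] unfolding K_def by blast
      then show ?thesis using c0[OF that] by simp
    qed
    then show False using ex_ad_comm_neq_0 by blast
  qed
  then obtain f y where f: "f \<in> ops" "c (ad_comm f y) \<noteq> 0" by blast
  define g where "g = ad_comm f y"
  have g: "g \<in> ops" using ad_comm_mem_ops f(1) by (simp add: g_def)
  note lin = ops_linear_simps[OF g]
  have pow_lin: "(g ^^ m) (x + y) = (g ^^ m) x + (g ^^ m) y" "(g ^^ m) 0 = 0"
    "(g ^^ m) (scale a x) = scale a ((g ^^ m) x)" for m x y a
    by (induction m) (simp_all add: lin)
  have pow_commute: "(g ^^ m) (h x) = h ((g ^^ m) x)" if "h \<in> ops" for m h x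
    by (induction m) (simp_all add: ops_commute[OF g that])
  have pow_mono: "(g ^^ m) x = 0" if "(g ^^ k) x = 0" "k \<le> m" for m k x
  proof -
    have "(g ^^ m) x = (g ^^ (m - k)) ((g ^^ k) x)"
      using that(2) by (simp flip: funpow_add[unfolded fun_eq_iff o_apply, rule_format])
    then show ?thesis using that(1) by (simp add: pow_lin)
  qed
  define K where "K = {z. \<exists>m. (g ^^ m) z = 0}"
  have "is_ideal K"
  proof (rule is_idealI)
    show "subspace K"
    proof (rule subspaceI)
      show "0 \<in> K" by (auto simp: K_def pow_lin)
      fix x y assume "x \<in> K" "y \<in> K"
      then obtain m n where "(g ^^ m) x = 0" "(g ^^ n) y = 0" by (auto simp: K_def)
      then have "(g ^^ max m n) (x + y) = 0"
        using pow_mono[of m x "max m n"] pow_mono[of n y "max m n"] by (simp add: pow_lin)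
      then show "x + y \<in> K" by (auto simp: K_def)
    next
      fix a x assume "x \<in> K"
      then show "scale a x \<in> K" by (auto simp: K_def pow_lin)
    qed
    show "a \<odot> x \<in> K" if "x \<in> K" for a x
    proof -
      obtain m where "(g ^^ m) x = 0" using \<open>x \<in> K\<close> by (auto simp: K_def)
      then have "(g ^^ m) (a \<odot> x) = 0"
        using pow_commute[OF circ_mem_ops, of m a x] by (simp add: circ_right_simps)
      then show ?thesis by (auto simp: K_def)
    qed
    \<comment> \<open>Moving one g past the bracket costs the error \<open>ad_comm g a\<close>,
      which commutes with g; one additional power of g suffices.\<close>
    have "(g ^^ Suc m) (bracket a x) = 0" if "(g ^^ m) x = 0" for m a x
      using that
    proof (induction m arbitrary: x)
      case (Suc m)
      have "(g ^^ Suc (Suc m)) (bracket a x) = (g ^^ Suc m) (bracket a (g x) + ad_comm g a x)"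
        unfolding ops_bracket[of g a x, symmetric] by (simp only: funpow_Suc_right o_apply)
      also have "\<dots> = (g ^^ Suc m) (bracket a (g x)) + ad_comm g a ((g ^^ Suc m) x)"
        by (simp only: pow_lin pow_commute[OF ad_comm_mem_ops[OF g]])
      also have "\<dots> = 0"
        using Suc.IH[of "g x"] Suc.prems ops_linear_simps(5)[OF ad_comm_mem_ops[OF g], of a]
        by (simp only: funpow_Suc_right o_apply) simp
      finally show ?case .
    qed (simp add: bracket_simps lin)
    then show "bracket a x \<in> K" if "x \<in> K" for a x using that unfolding K_def by blast
  qed
  moreover have "s \<notin> K"
  proof -
    have "g s = scale (c g) s" using s(2) g by blast
    then have "(g ^^ m) s = scale (c g ^ m) s" for m
      by (induction m) (simp_all add: lin mult.commute)
    then show ?thesis using s(1) f(2) by (simp add: K_def g_def)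
  qed
  ultimately have K: "K = {0}" using ideal_trivial by blast
  have "inj g"
  proof (rule injI)
    fix x y assume "g x = g y"
    then have "(g ^^ 1) (x - y) = 0" by (simp add: lin)
    then have "x - y \<in> K" unfolding K_def by blast
    then show "x = y" using K by simp
  qed
  moreover from this have "surj g" by (intro linear_inj_imp_surj ops_linear g)
  ultimately show ?thesis using f(1) by (auto simp: g_def)
qed

theorem ex_unital_differential_algebra:
  obtains mul e D q where
    "\<And>x y. mul x y = mul y x" "\<And>x y z. mul (mul x y) z = mul x (mul y z)" "\<And>x. mul e x = x"
    "\<And>x. Vector_Spaces.linear scale scale (mul x)"
    "Vector_Spaces.linear scale scale D" "\<And>x y. D (mul x y) = mul (D x) y + mul x (D y)"
    "\<And>x y. bracket x y = mul x (D y) - mul (D x) y"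
    "\<And>x y. x \<odot> y = mul (mul x q) y"
proof -
  obtain f y where f: "f \<in> ops" "inj (ad_comm f y)" "surj (ad_comm f y)"
    using ex_bijective_ad_comm by blast
  \<comment> \<open>This will be the unit: \<open>mul y e = y\<close>, and \<open>mul y\<close> can
    be cancelled.\<close>
  obtain e where e: "ad_comm f y e = y" using f(3) by (metis surjD)
  define mul where "mul = ad_comm f"
  define D where "D = bracket e"
  have mul_mem: "mul x \<in> ops" for x using ad_comm_mem_ops[OF f(1)] by (simp add: mul_def)
  note mul_lin = ops_linear_simps[OF mul_mem]
  have comm: "mul x y = mul y x" for x y
    unfolding mul_def by (rule ad_comm_commute[OF ops_half_derivation[OF f(1)]])
  have left_comm: "mul x (mul y z) = mul y (mul x z)" for x y z
    by (rule ops_commute[OF mul_mem mul_mem])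
  have assoc: "mul (mul x y) z = mul x (mul y z)" for x y z
    using left_comm[of z x y] comm by metis
  have unit: "mul e x = x" for x
  proof -
    have "mul y (mul e x) = mul y x"
      using e by (simp add: mul_def[symmetric]) (metis assoc comm)
    then show ?thesis using f(2) by (simp add: mul_def inj_eq)
  qed
  \<comment> \<open>The half-derivation rule of \<open>mul x\<close> for \<open>bracket e z\<close>,
    read with \<open>mul x e = x\<close>.\<close>
  have bracket1: "bracket x z = mul x (D z) + mul x (D z) - D (mul x z)" for x z
    using half_derivation_bracket_left[OF ops_half_derivation[OF mul_mem[of x]], of e z]
    by (simp add: D_def comm[of x e] unit)
  \<comment> \<open>Skew-symmetry of the bracket, expressed by \<open>bracket1\<close>, is twice the
    Leibniz rule.\<close>
  have D: "D (mul x z) = mul (D x) z + mul x (D z)" for x z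
  proof -
    have "bracket x z + bracket z x = 0" by (simp add: bracket_anticomm[of x z])
    then have "(mul x (D z) + mul z (D x)) + (mul x (D z) + mul z (D x)) = D (mul x z) + D (mul x z)"
      unfolding bracket1 using comm[of z x] by (simp add: algebra_simps)
    then show ?thesis unfolding double_cancel by (simp add: comm[of z] add.commute)
  qed
  \<comment> \<open>The original multiplications commute with every \<open>mul y\<close>, so they
    are determined by their values at the unit.\<close>
  have circ: "x \<odot> y = mul (mul x (e \<odot> e)) y" for x y
  proof -
    have *: "x \<odot> y = mul y (x \<odot> e)" for x y
      using ops_commute[OF mul_mem circ_mem_ops, of y x e] by (simp add: comm[of y e] unit)
    show ?thesis using *[of x y] *[of e x] mult_commute[of x e] comm by metis
  qed
  show ?thesis
  proof (rule that[of mul e D "e \<odot> e"])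
    show "Vector_Spaces.linear scale scale (mul x)" for x by (rule ops_linear[OF mul_mem])
    show "Vector_Spaces.linear scale scale D" unfolding D_def by (rule bracket_linear_right)
    show "bracket x y = mul x (D y) - mul (D x) y" for x y
      using bracket1[of x y] D[of x y] by (simp add: algebra_simps)
  qed (fact comm assoc unit D circ)+
qed

end

section \<open>The isomorphism with a Zassenhaus algebra\<close>

text \<open>\<open>dp_mult\<close> discards degrees from \<open>CHAR('k) ^ n\<close> on, so the full
  product must not reach them.\<close>

lemma hnth_mult_eq_dp_mult:
  fixes F G :: "'k::field hurwitz"
  assumes "\<And>i. CHAR('k) ^ n \<le> i \<Longrightarrow> hnth (F * G) i = 0"
  shows "hnth (F * G) = dp_mult n (hnth F) (hnth G)"
  by (rule ext) (use assms in \<open>auto simp: dp_mult_def hnth_mult not_less\<close>)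

lemma dp_deriv_hnth: "dp_deriv (hnth F) = hnth (hderiv F)"
  by (simp add: dp_deriv_def fun_eq_iff)

context alg_closed_vector_space
begin

lemma dim_eq_if_coordinates:
  fixes coord :: "'v \<Rightarrow> nat \<Rightarrow> 'k"
  assumes add: "\<And>x y i. coord (x + y) i = coord x i + coord y i"
    and scale: "\<And>a x i. coord (scale a x) i = a * coord x i"
    and bij: "bij_betw coord UNIV {f. \<forall>i\<ge>N. f i = 0}"
  shows "dim (UNIV :: 'v set) = N"
proof -
  have inj: "coord x = coord y \<Longrightarrow> x = y" for x y
    using bij by (auto simp: bij_betw_def inj_def)
  have ex: "\<exists>x. coord x = (\<lambda>i. if i = m then 1 else 0)" if "m < N" for m
  proof -
    have "(\<lambda>i. if i = m then 1 else 0) \<in> range coord"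
      using bij that by (auto simp: bij_betw_def)
    then show ?thesis by (metis rangeE)
  qed
  then obtain w where w: "\<And>m. m < N \<Longrightarrow> coord (w m) = (\<lambda>i. if i = m then 1 else 0)"
    by metis
  have zero: "coord 0 i = 0" for i using scale[of 0 0 i] by simp
  have coord_sum: "coord (\<Sum>m<N. scale (a m) (w m)) i = (if i < N then a i else 0)" for a i
  proof -
    have sum: "coord (sum g S) i = (\<Sum>m\<in>S. coord (g m) i)" for g and S :: "nat set"
      by (induction S rule: infinite_finite_induct) (simp_all add: zero add)
    have "coord (\<Sum>m<N. scale (a m) (w m)) i = (\<Sum>m<N. if i = m then a i else 0)"
      unfolding sum by (intro sum.cong) (auto simp: scale w)
    then show ?thesis by simp
  qed
  have inj_w: "inj_on w {..<N}"
  proof (rule inj_onI)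
    fix i j assume "i \<in> {..<N}" "j \<in> {..<N}" "w i = w j"
    then show "i = j" using w[of i] w[of j] by (metis lessThan_iff zero_neq_one)
  qed
  show ?thesis
  proof (rule dim_unique[of "w ` {..<N}"])
    show "independent (w ` {..<N})"
    proof (rule independent_if_scalars_zero)
      fix f x assume 0: "(\<Sum>x\<in>w ` {..<N}. scale (f x) x) = 0" and "x \<in> w ` {..<N}"
      then obtain m where m: "m < N" "x = w m" by auto
      have "(\<Sum>m<N. scale (f (w m)) (w m)) = 0"
        using 0 by (simp add: sum.reindex[OF inj_w])
      then show "f x = 0" using coord_sum[of "\<lambda>m. f (w m)" m] m by (simp add: zero)
    qed simp
    show "UNIV \<subseteq> span (w ` {..<N})"
    proof
      fix x
      have "coord x \<in> {f. \<forall>i\<ge>N. f i = 0}" using bij by (auto simp: bij_betw_def)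
      then have "x = (\<Sum>m<N. scale (coord x m) (w m))"
        by (intro inj ext) (simp add: coord_sum)
      also have "\<dots> \<in> span (w ` {..<N})"
        by (intro span_sum span_scale span_base) auto
      finally show "x \<in> span (w ` {..<N})" .
    qed
    show "card (w ` {..<N}) = N" using inj_w by (simp add: card_image)
  qed simp
qed

text \<open>Where the dimension is least, the descending chain has become constant and equals its
  intersection.\<close>

lemma ex_separating_index:
  assumes "\<And>i. subspace (J i)" "\<And>i. J (Suc i) \<subseteq> J i" "(\<Inter>i. J i) = {0}"
  shows "\<exists>N. J N = {0}"
proof -
  have "\<exists>N. \<forall>m. dim (J N) \<le> dim (J m)"
    using ex_has_least_nat[of "\<lambda>_. True" "0 :: nat" "\<lambda>i. dim (J i)"] by simp
  then obtain N where N: "\<And>m. dim (J N) \<le> dim (J m)" by blast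
  have anti: "J m \<subseteq> J N" if "N \<le> m" for m
    using that assms(2) by (rule lift_Suc_antimono_le[rotated])
  have "J N \<subseteq> J m" for m
  proof (cases "N \<le> m")
    case True
    have "J m = J N"
      by (intro subspace_dim_equal assms(1) anti[OF True] N)
    then show ?thesis by simp
  next
    case False
    then show ?thesis using lift_Suc_antimono_le[of J m N] assms(2) by auto
  qed
  then have "J N \<subseteq> {0}" using assms(3) by blast
  then show ?thesis using subspace_0[OF assms(1)] by blast
qed

end

context simple_tpa
begin

theorem iso_zassenhaus:
  "\<exists>n\<ge>1. dim (UNIV :: 'v set) = CHAR('k) ^ n \<and>
     (\<exists>q\<in>zassenhaus_carrier n. \<exists>\<phi>. is_iso_zassenhaus scale circ bracket n q \<phi>)"
proof -
  obtain mul e D q where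
    comm: "\<And>x y. mul x y = mul y x" and assoc: "\<And>x y z. mul (mul x y) z = mul x (mul y z)"
    and unit: "\<And>x. mul e x = x" and mul_linear: "\<And>x. Vector_Spaces.linear scale scale (mul x)"
    and D_linear: "Vector_Spaces.linear scale scale D"
    and D_mul: "\<And>x y. D (mul x y) = mul (D x) y + mul x (D y)"
    and bracket: "\<And>x y. bracket x y = mul x (D y) - mul (D x) y"
    and circ: "\<And>x y. x \<odot> y = mul (mul x q) y"
    by (rule ex_unital_differential_algebra) blast
  note mul = linear_simps[OF mul_linear] and D = linear_simps[OF D_linear]
  have mul_left: "mul (x + y) z = mul x z + mul y z" "mul (scale a x) z = scale a (mul x z)" for a x y z
    using mul(1)[of z x y] mul(4)[of z a x] by (simp_all add: comm[of _ z])
  obtain v0 :: 'v where "v0 \<noteq> 0" using simple by (auto simp: is_simple_def)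
  moreover have "mul x (mul y z) = mul y (mul x z)" for x y z
    using assoc comm by metis
  \<comment> \<open>The eigenvalues on a common eigenvector of the commuting multiplications define
    the character \<epsilon>.\<close>
  ultimately have "\<exists>s c. s \<noteq> 0 \<and> (\<forall>T\<in>range mul. T s = scale (c T) s)"
    by (intro common_eigenvector[of v0]) (auto simp: mul_linear)
  then obtain s \<epsilon> where s: "s \<noteq> 0" "\<And>x. mul x s = scale (\<epsilon> x) s"
  proof -
    assume *: "\<And>s \<epsilon>. s \<noteq> 0 \<Longrightarrow> (\<And>x. mul x s = scale (\<epsilon> x) s) \<Longrightarrow> thesis"
    assume "\<exists>s c. s \<noteq> 0 \<and> (\<forall>T\<in>range mul. T s = scale (c T) s)"
    then obtain s c where "s \<noteq> 0" "\<forall>T\<in>range mul. T s = scale (c T) s" by blast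
    then show thesis by (intro *[of s "\<lambda>x. c (mul x)"]) auto
  qed
  have \<epsilon>I: "\<epsilon> x = a" if "mul x s = scale a s" for x a
    using that s by simp
  have \<epsilon>_add: "\<epsilon> (x + y) = \<epsilon> x + \<epsilon> y" for x y
    by (rule \<epsilon>I, simp only: mul_left) (simp only: s scale_left_distrib)
  have \<epsilon>_scale: "\<epsilon> (scale a x) = a * \<epsilon> x" for a x
    by (rule \<epsilon>I, simp only: mul_left) (simp add: s)
  have \<epsilon>_mul: "\<epsilon> (mul x y) = \<epsilon> x * \<epsilon> y" for x y
    by (rule \<epsilon>I, simp only: assoc) (simp add: s mul mult.commute)
  have \<epsilon>_unit: "\<epsilon> e = 1" by (rule \<epsilon>I) (simp add: unit)

  define emb where "emb x = Hurwitz (\<lambda>i. \<epsilon> ((D ^^ i) x))" for x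
  have emb_0: "hnth (emb x) 0 = \<epsilon> x" for x by (simp add: emb_def)
  have hderiv_emb: "hderiv (emb x) = emb (D x)" for x
    by (rule hurwitz_eqI) (simp add: emb_def funpow_swap1)
  have emb_add: "emb (x + y) = emb x + emb y" for x y
  proof -
    have "(D ^^ i) (x + y) = (D ^^ i) x + (D ^^ i) y" for i
      by (induction i) (simp_all add: D)
    then show ?thesis by (intro hurwitz_eqI) (simp add: emb_def \<epsilon>_add)
  qed
  have emb_scale: "emb (scale a x) = hconst a * emb x" for a x
  proof -
    have "(D ^^ i) (scale a x) = scale a ((D ^^ i) x)" for i
      by (induction i) (simp_all add: D)
    then show ?thesis by (intro hurwitz_eqI) (simp add: emb_def \<epsilon>_scale)
  qed
  have emb_zero: "emb 0 = 0" using emb_add[of 0 0] by simp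
  have emb_diff: "emb (x - y) = emb x - emb y" for x y
    using emb_add[of "x - y" y] by simp
  have emb_mul: "emb (mul x y) = emb x * emb y" for x y
  proof -
    have "hnth (emb (mul x y)) i = hnth (emb x * emb y) i" for i
    proof (induction i arbitrary: x y)
      case (Suc i)
      have "hnth (emb (mul x y)) (Suc i) = hnth (emb (D (mul x y))) i"
        by (simp flip: hderiv_emb)
      then show ?case by (simp add: D_mul emb_add Suc hnth_mult_Suc hderiv_emb)
    qed (simp add: emb_0 \<epsilon>_mul)
    then show ?thesis by (rule hurwitz_eqI)
  qed
  have emb_unit: "emb e = 1"
  proof -
    have "D e = 0" using D_mul[of e e] by (simp add: unit comm[of "D e"])
    then show ?thesis
      by (subst hderiv_eq_iff) (simp add: hderiv_emb emb_zero emb_0 \<epsilon>_unit hnth_1)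
  qed
  have emb_bracket: "emb (bracket x y) = emb x * hderiv (emb y) - hderiv (emb x) * emb y" for x y
    by (simp add: bracket emb_diff emb_mul hderiv_emb)
  have emb_circ: "emb (x \<odot> y) = emb x * emb q * emb y" for x y
    by (simp add: circ emb_mul)
  \<comment> \<open>Both operations become expressions in products and \<open>hderiv\<close>, so the
    kernel is an ideal; it does not contain \<open>e\<close>.\<close>
  have kernel: "{x. emb x = 0} = {0}"
  proof -
    have "is_ideal {x. emb x = 0}"
      by (rule is_idealI)
        (auto simp: emb_circ emb_bracket emb_zero emb_add emb_scale intro: subspaceI)
    moreover have "e \<notin> {x. emb x = 0}" by (simp add: emb_unit)
    ultimately show ?thesis using ideal_trivial by blast
  qed
  then have inj_emb: "x = y" if "emb x = emb y" for x y
    using that emb_diff[of x y] by (metis (mono_tags, lifting) eq_iff_diff_eq_0 mem_Collect_eq singletonD)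

  have p: "prime CHAR('k)" using char_gt_3 by (intro prime_CHAR_semidom) simp
  have "\<exists>N. \<forall>f\<in>range emb. (\<forall>i<N. hnth f i = 0) \<longrightarrow> f = 0"
  proof -
    have "\<exists>N. {x. \<forall>i<N. hnth (emb x) i = 0} = {0}"
    proof (rule ex_separating_index)
      show "subspace {x. \<forall>i<N. hnth (emb x) i = 0}" for N
        by (rule subspaceI) (auto simp: emb_zero emb_add emb_scale)
      have "(\<Inter>N. {x. \<forall>i<N. hnth (emb x) i = 0}) = {x. emb x = 0}"
      proof (intro equalityI subsetI)
        fix x assume x: "x \<in> (\<Inter>N. {x. \<forall>i<N. hnth (emb x) i = 0})"
        have "hnth (emb x) i = 0" for i using x by (auto dest: INT_D[of _ _ _ "Suc i"])
        then show "x \<in> {x. emb x = 0}" by (auto intro: hurwitz_eqI)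
      qed auto
      then show "(\<Inter>N. {x. \<forall>i<N. hnth (emb x) i = 0}) = {0}" using kernel by simp
    qed auto
    then obtain N where N: "{x. \<forall>i<N. hnth (emb x) i = 0} = {0}" by blast
    have "emb x = 0" if "\<forall>i<N. hnth (emb x) i = 0" for x
    proof -
      have "x \<in> {x. \<forall>i<N. hnth (emb x) i = 0}" using that by simp
      then show ?thesis unfolding N by (simp add: emb_zero)
    qed
    then show ?thesis by blast
  qed
  then interpret A: hurwitz_subalgebra "range emb" "CHAR('k)"
  proof unfold_locales
    show "1 \<in> range emb" unfolding emb_unit[symmetric] by (rule rangeI)
    fix f g assume "f \<in> range emb" "g \<in> range emb"
    then show "f + g \<in> range emb" "f * g \<in> range emb"
      by (auto simp flip: emb_add emb_mul)
  next
    fix f c assume "f \<in> range emb"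
    then show "hconst c * f \<in> range emb" by (auto simp flip: emb_scale)
  next
    fix f assume "f \<in> range emb"
    then show "hderiv f \<in> range emb" by (auto simp: hderiv_emb)
  qed (use p in auto)
  define n where "n = A.exponent"
  define S :: "'k hurwitz set" where "S = {f. \<forall>i\<ge>CHAR('k) ^ n. hnth f i = 0}"
  obtain u v where u: "u \<in> range emb" "v \<in> range emb" "u * v = 1"
    and taylor_bij: "bij_betw (taylor u) (range emb) S"
    using A.ex_taylor_iso unfolding n_def S_def by blast
  have taylor_mem: "taylor u f \<in> S" if "f \<in> range emb" for f
    using taylor_bij that by (auto simp: bij_betw_def)

  \<comment> \<open>As vector fields \<open>f D = (v f) (u D)\<close>, so multiplication by v
    effects the change of derivation from D to \<open>u D\<close>.\<close>
  define \<psi> where "\<psi> x = taylor u (v * emb x)" for x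
  \<comment> \<open>A product of two images contains v twice instead of once; the factor u
    compensates.\<close>
  define q' where "q' = taylor u (u * emb q)"
  have \<psi>_bij: "bij_betw \<psi> UNIV S"
  proof -
    have "bij_betw (\<lambda>x. v * emb x) UNIV (range emb)"
      unfolding bij_betw_def
    proof
      show "inj (\<lambda>x. v * emb x)"
      proof (rule injI)
        fix x y assume "v * emb x = v * emb y"
        then have "u * v * emb x = u * v * emb y" by (simp only: mult.assoc)
        then show "x = y" using u(3) inj_emb by simp
      qed
      show "range (\<lambda>x. v * emb x) = range emb"
      proof safe
        fix x show "v * emb x \<in> range emb" by (intro A.mult_mem u) auto
        have "u * emb x \<in> range emb" by (intro A.mult_mem u) auto
        then obtain y where y: "u * emb x = emb y" by auto
        have "v * emb y = u * v * emb x" by (simp add: mult_ac flip: y)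
        then have "emb x = v * emb y" using u(3) by simp
        then show "emb x \<in> range (\<lambda>x. v * emb x)" by blast
      qed
    qed
    from bij_betw_trans[OF this taylor_bij] show ?thesis
      by (simp add: \<psi>_def[abs_def] comp_def)
  qed
  have \<psi>_mem: "\<psi> x \<in> S" for x using \<psi>_bij by (auto simp: bij_betw_def)
  have \<psi>_circ: "\<psi> (x \<odot> y) = \<psi> x * q' * \<psi> y" for x y
  proof -
    have "v * emb (x \<odot> y) = (u * v) * (v * emb x * emb q * emb y)"
      by (simp add: emb_circ u(3) mult_ac)
    also have "\<dots> = v * emb x * (u * emb q) * (v * emb y)" by (simp only: mult_ac)
    finally show ?thesis by (simp add: \<psi>_def q'_def taylor_mult)
  qed
  have twist_v: "twist u (v * f) = u * hderiv v * f + hderiv f" for f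
  proof -
    have "twist u (v * f) = u * hderiv v * f + u * v * hderiv f"
      by (simp add: twist_def hderiv_mult algebra_simps)
    then show ?thesis by (simp add: u(3))
  qed
  have \<psi>_bracket: "\<psi> (bracket x y) = \<psi> x * hderiv (\<psi> y) - hderiv (\<psi> x) * \<psi> y" for x y
  proof -
    have "v * emb (bracket x y) =
        v * emb x * twist u (v * emb y) - twist u (v * emb x) * (v * emb y)"
      unfolding twist_v emb_bracket by (simp add: algebra_simps)
    then show ?thesis
      unfolding \<psi>_def hderiv_taylor by (simp add: taylor_diff taylor_mult)
  qed

  define \<phi> where "\<phi> x = hnth (\<psi> x)" for x
  have \<phi>_bij: "bij_betw \<phi> UNIV {f. \<forall>i\<ge>CHAR('k) ^ n. f i = 0}"
  proof -
    have "bij_betw hnth S {f. \<forall>i\<ge>CHAR('k) ^ n. f i = 0}"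
      by (rule bij_betw_byWitness[where f' = Hurwitz]) (auto simp: S_def)
    from bij_betw_trans[OF \<psi>_bij this] show ?thesis by (simp add: \<phi>_def[abs_def] comp_def)
  qed
  have \<phi>_add: "\<phi> (x + y) i = \<phi> x i + \<phi> y i" for x y i
    by (simp add: \<phi>_def \<psi>_def emb_add distrib_left taylor_add)
  have \<phi>_scale: "\<phi> (scale a x) i = a * \<phi> x i" for a x i
  proof -
    have "v * emb (scale a x) = hconst a * (v * emb x)" by (simp add: emb_scale mult_ac)
    then show ?thesis by (simp add: \<phi>_def \<psi>_def taylor_mult)
  qed
  have dp_mult: "dp_mult n (hnth F) (hnth G) = hnth (F * G)" if "F * G \<in> S" for F G :: "'k hurwitz"
    using that by (intro hnth_mult_eq_dp_mult[symmetric]) (auto simp: S_def)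
  have "is_iso_zassenhaus scale circ bracket n (hnth q') \<phi>"
    unfolding is_iso_zassenhaus_def
  proof (intro conjI allI)
    have "module (coeff_scale :: 'k \<Rightarrow> _)"
      using vector_space_coeff_scale by (simp only: module_iff_vector_space)
    then show "Vector_Spaces.linear scale coeff_scale \<phi>"
      unfolding module_hom_iff_linear[symmetric] module_hom_iff
      by (simp add: module_axioms fun_eq_iff \<phi>_add \<phi>_scale coeff_scale_def)
    show "bij_betw \<phi> UNIV (zassenhaus_carrier n)"
      using \<phi>_bij by (simp add: zassenhaus_carrier_def dp_carrier_def)
    fix x y
    \<comment> \<open>Since \<open>dp_mult\<close> truncates at every step, each intermediate
      product must itself lie in \<open>S\<close>.\<close>
    have mem: "\<psi> x * q' \<in> S" "\<psi> x * hderiv (\<psi> y) \<in> S" "hderiv (\<psi> x) * \<psi> y \<in> S"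
    proof -
      have "v * emb x * (u * emb q) \<in> range emb" "v * emb x * twist u (v * emb y) \<in> range emb"
        "twist u (v * emb x) * (v * emb y) \<in> range emb"
        unfolding twist_def by (intro A.mult_mem A.hderiv_mem u rangeI)+
      from this[THEN taylor_mem]
      show "\<psi> x * q' \<in> S" "\<psi> x * hderiv (\<psi> y) \<in> S" "hderiv (\<psi> x) * \<psi> y \<in> S"
        unfolding \<psi>_def q'_def hderiv_taylor by (simp_all add: taylor_mult)
    qed
    have "\<psi> x * q' * \<psi> y \<in> S" unfolding \<psi>_circ[symmetric] by (rule \<psi>_mem)
    then show "\<phi> (x \<odot> y) = zassenhaus_mult_q n (hnth q') (\<phi> x) (\<phi> y)"
      by (simp add: \<phi>_def \<psi>_circ zassenhaus_mult_q_def zassenhaus_mult_def dp_mult mem)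
    show "\<phi> (bracket x y) = zassenhaus_bracket n (\<phi> x) (\<phi> y)"
      by (simp add: \<phi>_def \<psi>_bracket zassenhaus_bracket_def dp_deriv_hnth dp_mult mem fun_eq_iff)
  qed
  moreover have "hnth q' \<in> zassenhaus_carrier n"
  proof -
    have "q' \<in> S" unfolding q'_def by (intro taylor_mem A.mult_mem u rangeI)
    then show ?thesis by (simp add: zassenhaus_carrier_def dp_carrier_def S_def)
  qed
  moreover have "dim (UNIV :: 'v set) = CHAR('k) ^ n"
    by (rule dim_eq_if_coordinates[OF \<phi>_add \<phi>_scale \<phi>_bij])
  \<comment> \<open>For \<open>n = 0\<close> only constants remain and the bracket would
    vanish.\<close>
  moreover have "n \<ge> 1"
  proof (rule ccontr)
    assume "\<not> n \<ge> 1"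
    then have "n = 0" by simp
    then have "hderiv f = 0" if "f \<in> S" for f
      using that by (intro hurwitz_eqI) (simp add: S_def)
    then have "\<psi> (bracket x y) = \<psi> 0" for x y
      unfolding \<psi>_bracket using \<psi>_mem by (simp add: \<psi>_def emb_zero)
    then have "bracket x y = 0" for x y
      using \<psi>_bij by (auto simp: bij_betw_def dest: injD)
    then show False using nontrivial by (simp add: is_trivial_def)
  qed
  ultimately show ?thesis by blast
qed

end

theorem theorem3p5:
  fixes scale :: "'k::alg_closed_field \<Rightarrow> 'v::ab_group_add \<Rightarrow> 'v"
    and circ bracket :: "'v \<Rightarrow> 'v \<Rightarrow> 'v"
    and p :: nat
  assumes "CHAR('k) = p" and "p > 3"
    and "transposed_poisson_algebra scale circ bracket"
    and "\<exists>B. finite_dimensional_vector_space scale B"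
    and "transposed_poisson_algebra.is_simple scale circ bracket"
    and "\<not> transposed_poisson_algebra.is_trivial circ bracket"
  shows "\<exists>n\<ge>1. vector_space.dim scale (UNIV :: 'v set) = p ^ n \<and>
           (\<exists>q\<in>zassenhaus_carrier n. \<exists>\<phi>. is_iso_zassenhaus scale circ bracket n q \<phi>)"
proof -
  obtain B where "finite_dimensional_vector_space scale B" using assms(4) by blast
  then interpret simple_tpa scale circ bracket B
    using assms unfolding simple_tpa_def simple_tpa_axioms_def alg_closed_vector_space_def by simp
  show ?thesis using iso_zassenhaus assms(1) by simp
qed

end
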